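(* Let $\mathcal{D}$ be a central division algebra of characteristic $0$ with center $F$, let $n\ge 1$, let $c_0,\ldots,c_{n-1}\in\mathcal{D}$ with $c_0\ne 0$, and consider the left linear recurrence of order $n$ $$a_{k+n} = -c_0a_k-c_1a_{k+1}-\cdots-c_{n-1}a_{k+n-1}\qquad (k\ge 0)$$ with fixed initial conditions $a_0,\ldots,a_{n-1}\in\mathcal{D}$. Let $A\in M_n(\mathcal{D})$ be its companion matrix, and let $\phi(x)\in F[x]$ be the minimal polynomial of $A$ over $F$. If $\phi(x)$ factors in $\mathcal{D}[x]$ as a product of linear factors, then there exist distinct left eigenvalues $\lambda_1,\ldots,\lambda_t\in\mathcal{D}$ of $A$, positive integers $m_1,\ldots,m_t$ with $\sum_{i=1}^t m_i=n$, an invertible matrix $U\in M_n(\mathcal{D})$, and polynomials $p_1(x),\ldots,p_n(x)\in\mathcal{D}[x]$ such that, writing $M_0=0$ and $M_i=m_1+\cdots+m_i$ for $1\le i\le t$, we have $\deg p_j(x)<m_i$ whenever $M_{i-1}<j\le M_i$, and such that if we set $$\begin{bmatrix} b_1\\ b_2\\ \vdots\\ b_n\end{bmatrix}=U^{-1}\begin{bmatrix} a_0\\ a_1\\ \vdots\\ a_{n-1}\end{bmatrix},$$ then the unique solution to the linear recurrence with these initial conditions is $$a_k=\sum_{i=1}^t\ \sum_{j=M_{i-1}+1}^{M_i} p_j(k)\,\lambda_i^k\,b_j\qquad\text{for all } k\ge 0.$$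
   Context: A central division algebra is an associative unital division algebra $\mathcal{D}$ that is finite dimensional over its center $F$, a field. The companion matrix of the left linear recurrence $a_{k+n} = -c_0a_k-\cdots-c_{n-1}a_{k+n-1}$ is the $n\times n$ matrix $$A=\begin{bmatrix}0&1&0&\cdots&0\\0&0&1&\cdots&0\\ \vdots&\vdots&\vdots&\ddots&\vdots\\0&0&0&\cdots&1\\-c_0&-c_1&-c_2&\cdots&-c_{n-1}\end{bmatrix}.$$ An element $\lambda\in\mathcal{D}$ is a left eigenvalue of $B\in M_n(\mathcal{D})$ if there is a nonzero column vector $v\in\mathcal{D}^n$ with $Bv=\lambda v$. $\mathcal{D}[x]$ denotes the algebra of polynomials over $\mathcal{D}$ in a central indeterminate $x$, with coefficients written on the left; for $f(x)=\sum_s d_sx^s\in\mathcal{D}[x]$ and $\lambda\in\mathcal{D}$, $f(\lambda)=\sum_s d_s\lambda^s$. The minimal polynomial of $A$ over $F$ is the monic polynomial $\phi\in F[x]$ of least degree with $\phi(A)=0$ in the $F$-algebra $M_n(\mathcal{D})$. *)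

theory Defs
  imports Jordan_Normal_Form.Matrix "HOL-Library.Poly_Mapping"
begin

definition ring_center :: "'a::ring_1 set" where
  "ring_center = {z. \<forall>x. z * x = x * z}"

text \<open>A division ring that is spanned by a finite set over its center. The center is only a
  subset of the type, so the vector space locales of the library (scalars in a type of class
  field) do not apply.\<close>

definition central_division_algebra :: "'a::division_ring itself \<Rightarrow> bool" where
  "central_division_algebra _ \<longleftrightarrow>
     (\<exists>B::'a set. finite B \<and>
        (\<forall>x. \<exists>z. (\<forall>b\<in>B. z b \<in> ring_center) \<and> x = (\<Sum>b\<in>B. z b * b)))"

text \<open>Polynomials over a noncommutative ring in a central indeterminate: multiplication on the
  type \<open>'a poly\<close> needs commutative coefficients, whereas \<open>nat \<Rightarrow>\<^sub>0 'a\<close> carries the convolution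
  product for every semiring.\<close>

type_synonym 'a cpoly = "nat \<Rightarrow>\<^sub>0 'a"

text \<open>\<open>Poly_Mapping.degree\<close> is the usual degree plus one for nonzero arguments, and
  0 for the zero polynomial. Hence \<open>cdeg 0 = 0\<close>.\<close>

definition cdeg :: "'a::zero cpoly \<Rightarrow> nat" where
  "cdeg f = Poly_Mapping.degree f - 1"

definition cmonic :: "'a::{zero,one} cpoly \<Rightarrow> bool" where
  "cmonic f \<longleftrightarrow> Poly_Mapping.lookup f (cdeg f) = 1"

definition ceval :: "'a::semiring_1 cpoly \<Rightarrow> 'a \<Rightarrow> 'a" where
  "ceval f x = (\<Sum>s\<in>Poly_Mapping.keys f. Poly_Mapping.lookup f s * x ^ s)"

text \<open>The sum \<open>\<Sum>\<^sub>s f\<^sub>s A\<^sup>s\<close> for a square matrix, written entrywise because matrices of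
  arbitrary dimensions form no additive monoid type.\<close>

definition ceval_mat :: "'a::semiring_1 cpoly \<Rightarrow> 'a mat \<Rightarrow> 'a mat" where
  "ceval_mat f A = mat (dim_row A) (dim_row A)
     (\<lambda>ij. \<Sum>s\<in>Poly_Mapping.keys f. (Poly_Mapping.lookup f s \<cdot>\<^sub>m (A ^\<^sub>m s)) $$ ij)"

definition center_annihilator :: "'a::ring_1 mat \<Rightarrow> 'a cpoly \<Rightarrow> bool" where
  "center_annihilator A f \<longleftrightarrow>
     (\<forall>s. Poly_Mapping.lookup f s \<in> ring_center) \<and> cmonic f \<and>
     ceval_mat f A = 0\<^sub>m (dim_row A) (dim_row A)"

definition is_center_minpoly :: "'a::ring_1 mat \<Rightarrow> 'a cpoly \<Rightarrow> bool" where
  "is_center_minpoly A f \<longleftrightarrow>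
     center_annihilator A f \<and> (\<forall>g. center_annihilator A g \<longrightarrow> cdeg f \<le> cdeg g)"

definition product_of_linear_factors :: "'a::ring_1 cpoly \<Rightarrow> bool" where
  "product_of_linear_factors f \<longleftrightarrow>
     (\<exists>ls. (\<forall>l\<in>set ls. cdeg l = 1) \<and> f = prod_list ls)"

definition left_eigenvalue :: "'a::ring_1 mat \<Rightarrow> 'a \<Rightarrow> bool" where
  "left_eigenvalue B l \<longleftrightarrow>
     (\<exists>v\<in>carrier_vec (dim_row B). v \<noteq> 0\<^sub>v (dim_row B) \<and> B *\<^sub>v v = l \<cdot>\<^sub>v v)"

definition recurrence_companion :: "nat \<Rightarrow> (nat \<Rightarrow> 'a::ring_1) \<Rightarrow> 'a mat" where
  "recurrence_companion n c = mat n n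
     (\<lambda>(i, j). if i + 1 = n then - c j else if j = i + 1 then 1 else 0)"

definition solves_recurrence ::
    "nat \<Rightarrow> (nat \<Rightarrow> 'a::ring_1) \<Rightarrow> (nat \<Rightarrow> 'a) \<Rightarrow> (nat \<Rightarrow> 'a) \<Rightarrow> bool" where
  "solves_recurrence n c init a \<longleftrightarrow>
     (\<forall>i<n. a i = init i) \<and> (\<forall>k. a (k + n) = - (\<Sum>i<n. c i * a (k + i)))"

end

theory Submission
  imports Defs "HOL-Library.Function_Algebras"
begin

text \<open>
  The solutions of the recurrence form a right vector space \<open>V\<close> over the division ring, of dimension
  \<open>n\<close>, on which the shift acts linearly. Let \<open>sdiff \<mu> v = shift v - v \<mu>\<close>. A sequence with
  \<open>sdiff\<^sup>m \<mu> v = 0\<close> has the form \<open>p(k) \<mu>\<^sup>k\<close> with \<open>deg p < m\<close>, by the binomial theorem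
  (\<open>gen_eigen_polynomial_exponential\<close>). So what is needed is a basis of \<open>V\<close> consisting of chains
  \<open>v, sdiff \<lambda> v, \<dots>, sdiff\<^sup>m\<^sup>-\<^sup>1 \<lambda> v\<close>, that is, a Jordan form of the shift; the matrix \<open>U\<close> has the
  initial segments of the basis as its columns.

  Generalized eigenvectors span \<open>V\<close> (\<open>gen_eigen_span\<close>). The central polynomial \<open>\<phi>\<close> annihilates the
  companion matrix and hence \<open>V\<close>. Let \<open>G\<close> be the span of the generalized eigenvectors. If
  \<open>G \<noteq> V\<close>, the linear factors of \<open>\<phi>\<close>, applied one after the other, produce some \<open>w\<close> outside
  of \<open>G\<close> with \<open>sdiff \<mu> w\<close> in \<open>G\<close>. The Taylor expansion of \<open>\<phi>\<close> at \<open>\<mu>\<close> then yields a generalized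
  eigenvector that is congruent modulo \<open>G\<close> to a nonzero multiple of \<open>w\<close>, a contradiction.

  Among the finite sets of chains that span \<open>V\<close>, one of least total length is independent
  (\<open>exists_independent_chains\<close>). Take a nontrivial relation that involves chain members as close to
  the eigenvectors as possible. If it goes beyond the eigenvectors, minimality provides an element
  \<open>e\<close> with \<open>e \<mu> - \<mu> e = 1\<close>, which is impossible in characteristic 0 because \<open>\<phi>(\<mu>) = 0\<close>
  (\<open>unit_commutator_transcendental\<close>). If it is a relation between eigenvectors, then after rescaling
  they belong to the same eigenvalue, and one of the chains can be replaced by a shorter one.

  Finally the eigenvector \<open>(u \<mu>\<^sup>k)\<^sub>k\<close> at the end of a chain is rescaled to \<open>(\<lambda>\<^sup>k)\<^sub>k\<close> with
  \<open>\<lambda> = u \<mu> u\<^sup>-\<^sup>1\<close>. As \<open>(\<lambda>\<^sup>k)\<^sub>k\<close> is a solution, \<open>\<lambda>\<close> is a left eigenvalue of the companion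
  matrix, and independence makes these \<open>\<lambda>\<close> distinct.
\<close>

section \<open>Sequences and the shift\<close>

text \<open>Sequences are added as elements of a function type. The pointwise rules are kept out of the
  simpset, which would otherwise expand sums of sequences into abstractions.\<close>

declare plus_fun_apply [simp del] zero_fun_apply [simp del] minus_apply [simp del] uminus_apply [simp del]

lemma sum_fun_apply: "(\<Sum>i\<in>A. f i) k = (\<Sum>i\<in>A. f i k)" for f :: "'i \<Rightarrow> 'b \<Rightarrow> 'c::comm_monoid_add"
  by (induction A rule: infinite_finite_induct) (auto simp: plus_fun_apply zero_fun_apply)

lemma funpow_left_commute: "(f ^^ a) ((f ^^ b) x) = (f ^^ b) ((f ^^ a) x)"
  by (metis add.commute comp_apply funpow_add)

text \<open>Sequences form a right vector space; all scalars act on the right.\<close>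

definition rscale :: "(nat \<Rightarrow> 'a::semiring_0) \<Rightarrow> 'a \<Rightarrow> nat \<Rightarrow> 'a" (infixl \<open>\<star>\<close> 75) where
  "v \<star> d = (\<lambda>k. v k * d)"

definition shift :: "(nat \<Rightarrow> 'a) \<Rightarrow> nat \<Rightarrow> 'a" where
  "shift v = (\<lambda>k. v (Suc k))"

text \<open>The operator \<open>v \<mapsto> shift v - v \<star> \<mu>\<close>. It is additive but commutes only with those right
  scalars that commute with \<open>\<mu>\<close>.\<close>

definition sdiff :: "'a::ring \<Rightarrow> (nat \<Rightarrow> 'a) \<Rightarrow> nat \<Rightarrow> 'a" where
  "sdiff \<mu> v = (\<lambda>k. v (Suc k) - v k * \<mu>)"

lemma rscale_apply: "(v \<star> d) k = v k * d"
  by (simp add: rscale_def)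

lemma shift_apply: "shift v k = v (Suc k)"
  by (simp add: shift_def)

lemma sdiff_apply: "sdiff \<mu> v k = v (Suc k) - v k * \<mu>"
  by (simp add: sdiff_def)

lemmas seq_apply = rscale_apply shift_apply sdiff_apply plus_fun_apply zero_fun_apply
  minus_apply uminus_apply sum_fun_apply

lemma rscale_rscale: "v \<star> d \<star> e = v \<star> (d * e)" for v :: "nat \<Rightarrow> 'a::semiring_0"
  by (simp add: fun_eq_iff seq_apply mult.assoc)

lemma rscale_one [simp]: "v \<star> 1 = v" for v :: "nat \<Rightarrow> 'a::semiring_1"
  by (simp add: fun_eq_iff seq_apply)

lemma rscale_zero [simp]: "v \<star> 0 = 0" "0 \<star> d = 0" for v :: "nat \<Rightarrow> 'a::semiring_0"
  by (simp_all add: fun_eq_iff seq_apply)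

lemma rscale_add_left: "(v + w) \<star> d = v \<star> d + w \<star> d" for v :: "nat \<Rightarrow> 'a::semiring_0"
  by (simp add: fun_eq_iff seq_apply algebra_simps)

lemma rscale_add_right: "v \<star> (d + e) = v \<star> d + v \<star> e" for v :: "nat \<Rightarrow> 'a::semiring_0"
  by (simp add: fun_eq_iff seq_apply algebra_simps)

lemma rscale_diff_right: "v \<star> (d - e) = v \<star> d - v \<star> e" for v :: "nat \<Rightarrow> 'a::ring"
  by (simp add: fun_eq_iff seq_apply algebra_simps)

lemma rscale_minus_one [simp]: "v \<star> (-1) = - v" for v :: "nat \<Rightarrow> 'a::ring_1"
  by (simp add: fun_eq_iff seq_apply)

lemma rscale_sum_left: "(\<Sum>i\<in>A. f i) \<star> d = (\<Sum>i\<in>A. f i \<star> d)" for d :: "'a::semiring_0"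
  by (induction A rule: infinite_finite_induct) (auto simp: rscale_add_left)

lemma rscale_sum_right: "v \<star> (\<Sum>i\<in>A. f i) = (\<Sum>i\<in>A. v \<star> f i)" for v :: "nat \<Rightarrow> 'a::semiring_0"
  by (induction A rule: infinite_finite_induct) (auto simp: rscale_add_right)

lemma shift_add: "shift (v + w) = shift v + shift w"
  by (simp add: fun_eq_iff seq_apply)

lemma shift_zero: "shift 0 = 0"
  by (simp add: fun_eq_iff seq_apply)

lemma shift_sum: "shift (\<Sum>i\<in>A. f i) = (\<Sum>i\<in>A. shift (f i))"
  for f :: "'i \<Rightarrow> nat \<Rightarrow> 'a::comm_monoid_add"
  by (simp add: fun_eq_iff seq_apply)

lemma shift_rscale: "shift (v \<star> d) = shift v \<star> d"
  by (simp add: fun_eq_iff seq_apply)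

lemma shift_eq_sdiff: "shift v = sdiff \<mu> v + v \<star> \<mu>"
  by (simp add: fun_eq_iff seq_apply)

lemma sdiff_eq_shift: "sdiff \<mu> v = shift v + v \<star> (- \<mu>)"
  by (simp add: fun_eq_iff seq_apply)

lemma sdiff_add: "sdiff \<mu> (v + w) = sdiff \<mu> v + sdiff \<mu> w"
  by (simp add: fun_eq_iff seq_apply algebra_simps)

lemma sdiff_zero [simp]: "sdiff \<mu> 0 = 0"
  by (simp add: fun_eq_iff seq_apply)

lemma sdiff_shift: "sdiff \<mu> (shift v) = shift (sdiff \<mu> v)"
  by (simp add: fun_eq_iff seq_apply)

lemma sdiff_rscale: "\<mu> * d = d * \<nu> \<Longrightarrow> sdiff \<nu> (v \<star> d) = sdiff \<mu> v \<star> d"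
  by (simp add: fun_eq_iff seq_apply algebra_simps)

lemma funpow_sdiff_zero [simp]: "(sdiff \<mu> ^^ j) 0 = 0"
  by (induction j) auto

lemma funpow_sdiff_add: "(sdiff \<mu> ^^ j) (v + w) = (sdiff \<mu> ^^ j) v + (sdiff \<mu> ^^ j) w"
  by (induction j) (auto simp: sdiff_add)

lemma funpow_sdiff_sum: "(sdiff \<mu> ^^ j) (\<Sum>i\<in>A. f i) = (\<Sum>i\<in>A. (sdiff \<mu> ^^ j) (f i))"
  by (induction A rule: infinite_finite_induct) (auto simp: funpow_sdiff_add)

lemma funpow_sdiff_shift: "(sdiff \<mu> ^^ j) (shift v) = shift ((sdiff \<mu> ^^ j) v)"
  by (induction j) (auto simp: sdiff_shift)

lemma funpow_sdiff_rscale: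
  assumes "\<mu> * d = d * \<nu>"
  shows "(sdiff \<nu> ^^ j) (v \<star> d) = (sdiff \<mu> ^^ j) v \<star> d"
  by (induction j) (auto simp: sdiff_rscale[OF assms])

lemma sdiff_eq_0_iff: "sdiff \<mu> v = 0 \<longleftrightarrow> (\<forall>k. v k = v 0 * \<mu> ^ k)" for \<mu> :: "'a::ring_1"
proof
  assume *: "sdiff \<mu> v = 0"
  have "v (Suc k) = v k * \<mu>" for k
    using fun_cong[OF *, of k] by (simp add: seq_apply)
  hence "v k = v 0 * \<mu> ^ k" for k
    by (induction k) (auto simp: mult.assoc power_Suc2 simp del: power_Suc)
  thus "\<forall>k. v k = v 0 * \<mu> ^ k" by blast
next
  assume *: "\<forall>k. v k = v 0 * \<mu> ^ k"
  show "sdiff \<mu> v = 0"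
  proof
    fix k
    have "v (Suc k) = v k * \<mu>"
      using *[rule_format, of k] *[rule_format, of "Suc k"] by (simp add: mult.assoc power_Suc2 del: power_Suc)
    thus "sdiff \<mu> v k = 0 k" by (simp add: seq_apply)
  qed
qed

text \<open>Binomial theorem for \<open>shift = sdiff \<mu> + (\<star> \<mu>)\<close>, a sum of commuting operators.\<close>

lemma shift_binomial:
  fixes v :: "nat \<Rightarrow> 'a::ring_1"
  shows "v (k + s) = (\<Sum>j\<le>s. of_nat (s choose j) * ((sdiff \<mu> ^^ j) v k * \<mu> ^ (s - j)))"
proof (induction s arbitrary: v)
  case 0
  thus ?case by simp
next
  case (Suc s)
  let ?f = "\<lambda>n j. (sdiff \<mu> ^^ j) v k * \<mu> ^ (n - j)"
  have "v (k + Suc s) = shift v (k + s)"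
    by (simp add: seq_apply)
  also have "\<dots> = (\<Sum>j\<le>s. of_nat (s choose j) * ((sdiff \<mu> ^^ j) (shift v) k * \<mu> ^ (s - j)))"
    by (rule Suc.IH)
  also have "\<dots> = (\<Sum>j\<le>s. of_nat (s choose j) * ?f (Suc s) (Suc j)) + (\<Sum>j\<le>s. of_nat (s choose j) * ?f (Suc s) j)"
    unfolding sum.distrib[symmetric]
  proof (rule sum.cong)
    fix j assume "j \<in> {..s}"
    hence j: "Suc s - j = Suc (s - j)" by auto
    have "(sdiff \<mu> ^^ j) (shift v) k = (sdiff \<mu> ^^ Suc j) v k + (sdiff \<mu> ^^ j) v k * \<mu>"
      by (simp add: funpow_sdiff_shift seq_apply)
    thus "of_nat (s choose j) * ((sdiff \<mu> ^^ j) (shift v) k * \<mu> ^ (s - j)) =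
        of_nat (s choose j) * ?f (Suc s) (Suc j) + of_nat (s choose j) * ?f (Suc s) j"
      by (simp add: j algebra_simps del: funpow.simps)
  qed auto
  also have "(\<Sum>j\<le>s. of_nat (s choose j) * ?f (Suc s) j) = (\<Sum>j\<le>Suc s. of_nat (s choose j) * ?f (Suc s) j)"
    by (simp add: binomial_eq_0)
  also have "\<dots> = ?f (Suc s) 0 + (\<Sum>j\<le>s. of_nat (s choose Suc j) * ?f (Suc s) (Suc j))"
    by (subst sum.atMost_Suc_shift) simp
  also have "(\<Sum>j\<le>s. of_nat (s choose j) * ?f (Suc s) (Suc j)) + \<dots> =
       ?f (Suc s) 0 + (\<Sum>j\<le>s. of_nat (Suc s choose Suc j) * ?f (Suc s) (Suc j))"
    by (simp add: sum.distrib algebra_simps del: funpow.simps)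
  also have "\<dots> = (\<Sum>j\<le>Suc s. of_nat (Suc s choose j) * ?f (Suc s) j)"
    by (subst sum.atMost_Suc_shift) (simp del: funpow.simps)
  finally show ?case .
qed

section \<open>The right action of polynomials\<close>

text \<open>Polynomials act on sequences from the right, the indeterminate as the shift. Coefficients
  stand on the right of the terms of the sequence, so that a product of polynomials acts as the
  composition of the actions of its factors, the leftmost factor first.\<close>

definition act :: "(nat \<Rightarrow> 'a::semiring_0) \<Rightarrow> 'a cpoly \<Rightarrow> nat \<Rightarrow> 'a" where
  "act v g = (\<lambda>k. \<Sum>s\<in>Poly_Mapping.keys g. v (k + s) * Poly_Mapping.lookup g s)"

lemma act_superset:
  assumes "finite A" "Poly_Mapping.keys g \<subseteq> A"
  shows "act v g k = (\<Sum>s\<in>A. v (k + s) * Poly_Mapping.lookup g s)"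
  unfolding act_def by (rule sum.mono_neutral_left) (use assms in \<open>auto simp: in_keys_iff\<close>)

lemma act_eq_sum_atMost: "act v g k = (\<Sum>s\<le>cdeg g. v (k + s) * Poly_Mapping.lookup g s)"
proof (rule act_superset)
  show "Poly_Mapping.keys g \<subseteq> {..cdeg g}"
    by (auto simp: cdeg_def dest!: in_keys_less_degree)
qed auto

lemma act_add: "act v (g + h) = act v g + act v h"
proof
  fix k
  let ?A = "Poly_Mapping.keys g \<union> Poly_Mapping.keys h"
  show "act v (g + h) k = (act v g + act v h) k"
    using act_superset[of ?A "g + h" v k] act_superset[of ?A g v k] act_superset[of ?A h v k]
      keys_add[of g h]
    by (simp add: seq_apply lookup_add distrib_left sum.distrib)
qed

lemma act_zero [simp]: "act v 0 = 0"
  by (simp add: act_def fun_eq_iff seq_apply)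

lemma act_single: "act v (Poly_Mapping.single s a) = (shift ^^ s) v \<star> a"
proof
  fix k
  have "(shift ^^ s) v k = v (k + s)" for k
    by (induction s arbitrary: k) (auto simp: seq_apply)
  thus "act v (Poly_Mapping.single s a) k = ((shift ^^ s) v \<star> a) k"
    using act_superset[of "{s}" "Poly_Mapping.single s a" v k] by (simp add: seq_apply)
qed

lemma act_one [simp]: "act v 1 = v" for v :: "nat \<Rightarrow> 'a::semiring_1"
  using act_single[of v 0 1] by simp

lemma cpoly_induct:
  assumes "P 0" "\<And>s a. P (Poly_Mapping.single s a)" "\<And>g h. P g \<Longrightarrow> P h \<Longrightarrow> P (g + h)"
  shows "P (g :: 'a::comm_monoid_add cpoly)"
proof (induction g rule: Poly_Mapping.update_induct)
  case (update f a b)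
  have "Poly_Mapping.update a b f = f + Poly_Mapping.single a b"
    using update(1) by (intro poly_mapping_eqI)
      (auto simp: lookup_add lookup_update lookup_single when_def in_keys_iff)
  thus ?case using assms update by simp
qed (fact assms(1))

lemma act_mult: "act v (g * h) = act (act v g) h" for v :: "nat \<Rightarrow> 'a::semiring_1"
proof (induction h rule: cpoly_induct)
  case (2 s a)
  show ?case
  proof (induction g rule: cpoly_induct)
    case (2 r b)
    have "(shift ^^ s) (w \<star> b) = (shift ^^ s) w \<star> b" for w
      by (induction s) (auto simp: shift_rscale)
    thus ?case
      by (simp add: mult_single act_single rscale_rscale funpow_add add.commute[of r s])
  next
    case (3 g h)
    have "(shift ^^ s) (u + w) = (shift ^^ s) u + (shift ^^ s) w" for u w :: "nat \<Rightarrow> 'a"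
      by (induction s) (auto simp: shift_add)
    thus ?case using 3
      by (simp add: act_add distrib_right act_single rscale_add_left)
  next
    case 1
    have "(shift ^^ s) 0 = (0 :: nat \<Rightarrow> 'a)"
      by (induction s) (auto simp: shift_zero)
    thus ?case by (simp add: act_single)
  qed
qed (auto simp: act_add distrib_left)

section \<open>Shift-invariant subspaces and generalized eigenvectors\<close>

text \<open>The right linear span of a set of sequences.\<close>

inductive_set rspan :: "(nat \<Rightarrow> 'a::ring_1) set \<Rightarrow> (nat \<Rightarrow> 'a) set" for B where
  rspan_zero: "0 \<in> rspan B"
| rspan_step: "b \<in> B \<Longrightarrow> x \<in> rspan B \<Longrightarrow> b \<star> d + x \<in> rspan B"

lemma rspan_scaled_base: "b \<in> B \<Longrightarrow> b \<star> d \<in> rspan B"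
  using rspan_step[of b B 0 d] by (simp add: rspan_zero)

lemma rspan_base: "b \<in> B \<Longrightarrow> b \<in> rspan B"
  using rspan_scaled_base[of b B 1] by simp

lemma rspan_add: "x \<in> rspan B \<Longrightarrow> y \<in> rspan B \<Longrightarrow> x + y \<in> rspan B"
  by (induction x rule: rspan.induct) (auto simp: add.assoc intro: rspan.intros)

lemma rspan_scale: "x \<in> rspan B \<Longrightarrow> x \<star> d \<in> rspan B"
  by (induction x rule: rspan.induct)
    (auto simp: rscale_add_left rscale_rscale intro: rspan.intros)

lemma rspan_sum: "(\<And>i. i \<in> A \<Longrightarrow> f i \<in> rspan B) \<Longrightarrow> (\<Sum>i\<in>A. f i) \<in> rspan B"
  by (induction A rule: infinite_finite_induct) (auto intro: rspan_add rspan_zero)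

lemma rspan_diff: "x \<in> rspan B \<Longrightarrow> y \<in> rspan B \<Longrightarrow> x - y \<in> rspan B"
  using rspan_add[of x B "y \<star> (-1)"] rspan_scale[of y B "-1"] by simp

lemma rspan_subset: "B \<subseteq> rspan C \<Longrightarrow> rspan B \<subseteq> rspan C"
proof
  fix x assume "x \<in> rspan B" "B \<subseteq> rspan C"
  thus "x \<in> rspan C"
    by (induction x rule: rspan.induct) (auto intro: rspan_add rspan_scale rspan_zero)
qed

lemma rspan_mono: "B \<subseteq> C \<Longrightarrow> rspan B \<subseteq> rspan C"
  by (rule rspan_subset) (auto intro: rspan_base)

lemma rspan_finite_subset: "x \<in> rspan B \<Longrightarrow> \<exists>C. finite C \<and> C \<subseteq> B \<and> x \<in> rspan C"
proof (induction x rule: rspan.induct)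
  case rspan_zero
  show ?case by (auto intro!: exI[of _ "{}"] rspan.rspan_zero)
next
  case (rspan_step b x d)
  then obtain C where "finite C" "C \<subseteq> B" "x \<in> rspan C"
    by blast
  hence "b \<star> d + x \<in> rspan (insert b C)"
    using rspan_mono[of C "insert b C"] by (intro rspan.rspan_step) auto
  thus ?case
    using \<open>finite C\<close> \<open>C \<subseteq> B\<close> rspan_step by (intro exI[of _ "insert b C"]) auto
qed

lemma rspan_image_sum:
  assumes "x \<in> rspan (e ` I)" "finite I"
  shows "\<exists>d. x = (\<Sum>i\<in>I. e i \<star> d i)"
  using assms(1)
proof (induction x rule: rspan.induct)
  case rspan_zero
  show ?case by (auto intro!: exI[of _ "\<lambda>_. 0"])
next
  case (rspan_step b x d)
  then obtain d' i where d': "x = (\<Sum>i\<in>I. e i \<star> d' i)" and i: "i \<in> I" "b = e i"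
    by blast
  have "(\<Sum>j\<in>I. e j \<star> (d' j + (if j = i then d else 0))) = x + (\<Sum>j\<in>I. if j = i then e j \<star> d else 0)"
    unfolding d' sum.distrib[symmetric] by (rule sum.cong) (auto simp: rscale_add_right)
  also have "\<dots> = b \<star> d + x"
    using i assms(2) by (simp add: add.commute)
  finally show ?case by metis
qed

text \<open>A right linear subspace that is invariant under the shift, that is, a module over the
  polynomials acting by \<open>act\<close>.\<close>

locale shift_space =
  fixes V :: "(nat \<Rightarrow> 'a::ring_1) set"
  assumes zero_mem: "0 \<in> V"
    and add_mem: "v \<in> V \<Longrightarrow> w \<in> V \<Longrightarrow> v + w \<in> V"
    and scale_mem: "v \<in> V \<Longrightarrow> v \<star> d \<in> V"
    and shift_mem: "v \<in> V \<Longrightarrow> shift v \<in> V"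
begin

lemma sum_mem: "(\<And>i. i \<in> A \<Longrightarrow> f i \<in> V) \<Longrightarrow> (\<Sum>i\<in>A. f i) \<in> V"
  by (induction A rule: infinite_finite_induct) (auto intro: add_mem zero_mem)

lemma diff_mem: "v \<in> V \<Longrightarrow> w \<in> V \<Longrightarrow> v - w \<in> V"
  using add_mem[of v "w \<star> (-1)"] scale_mem[of w "-1"] by simp

lemma sdiff_mem: "v \<in> V \<Longrightarrow> sdiff \<mu> v \<in> V"
  unfolding sdiff_eq_shift by (intro add_mem shift_mem scale_mem)

lemma funpow_sdiff_mem: "v \<in> V \<Longrightarrow> (sdiff \<mu> ^^ j) v \<in> V"
  by (induction j) (auto intro: sdiff_mem)

lemma act_mem: "v \<in> V \<Longrightarrow> act v g \<in> V"
proof (induction g rule: cpoly_induct)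
  case (2 s a)
  have "(shift ^^ s) v \<in> V"
    using 2 by (induction s) (auto intro: shift_mem)
  thus ?case by (simp add: act_single scale_mem)
qed (auto simp: act_add intro: zero_mem add_mem)

lemma rspan_subset_space: "B \<subseteq> V \<Longrightarrow> rspan B \<subseteq> V"
proof
  fix x assume "x \<in> rspan B" "B \<subseteq> V"
  thus "x \<in> V"
    by (induction x rule: rspan.induct) (auto intro: add_mem scale_mem zero_mem)
qed

end

text \<open>If a product of linear factors sends \<open>w\<close> from outside of \<open>G\<close> into \<open>G\<close>, then one of the
  factors does this to the image of \<open>w\<close> under the preceding ones. This is the only use made of the
  factorization.\<close>

lemma exists_eigenvector_modulo:
  fixes V G :: "(nat \<Rightarrow> 'a::division_ring) set"
  assumes "shift_space V" "shift_space G"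
    and "\<forall>l\<in>set ls. cdeg l = 1" "w \<in> V" "w \<notin> G" "act w (prod_list ls) \<in> G"
  shows "\<exists>w\<in>V - G. \<exists>\<mu>. sdiff \<mu> w \<in> G"
  using assms(3-)
proof (induction ls arbitrary: w)
  case Nil
  thus ?case by simp
next
  case (Cons l ls)
  interpret V: shift_space V by fact
  interpret G: shift_space G by fact
  show ?case
  proof (cases "act w l \<in> G")
    case False
    thus ?thesis
      using Cons.prems V.act_mem[of w l] by (intro Cons.IH[of "act w l"]) (auto simp: act_mult)
  next
    case True
    \<comment> \<open>Up to the right factor \<open>\<alpha>\<close>, the action of \<open>l = \<alpha> x + \<beta>\<close> is \<open>sdiff \<mu>\<close> with
      \<open>\<mu> = - \<beta> \<alpha>\<^sup>-\<^sup>1\<close>.\<close>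
    define \<alpha> where "\<alpha> = Poly_Mapping.lookup l 1"
    define \<beta> where "\<beta> = Poly_Mapping.lookup l 0"
    have "cdeg l = 1"
      using Cons.prems by simp
    hence deg: "Poly_Mapping.degree l = 2"
      by (simp add: cdeg_def)
    hence "\<alpha> \<noteq> 0"
      using degree_greater_zero_in_keys[of l] by (simp add: \<alpha>_def in_keys_iff)
    have "act w l = shift w \<star> \<alpha> + w \<star> \<beta>"
      using \<open>cdeg l = 1\<close> by (simp add: fun_eq_iff act_eq_sum_atMost seq_apply \<alpha>_def \<beta>_def add.commute)
    hence "act w l \<star> inverse \<alpha> = sdiff (- \<beta> * inverse \<alpha>) w"
      using \<open>\<alpha> \<noteq> 0\<close> by (simp add: fun_eq_iff seq_apply algebra_simps)
    thus ?thesis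
      using Cons.prems True G.scale_mem[of "act w l" "inverse \<alpha>"] by auto
  qed
qed

text \<open>The generalized eigenvectors of the shift in \<open>V\<close>, for all eigenvalues together, with the zero
  sequence. This set is closed under right scalars, which conjugate the eigenvalue, but in general not
  under addition.\<close>

definition gen_eigen :: "(nat \<Rightarrow> 'a::ring_1) set \<Rightarrow> (nat \<Rightarrow> 'a) set" where
  "gen_eigen V = {v \<in> V. \<exists>\<mu> m. (sdiff \<mu> ^^ m) v = 0}"

lemma shift_space_gen_eigen:
  assumes "shift_space V"
  shows "shift_space (rspan (gen_eigen V))"
proof
  interpret shift_space V by fact
  have *: "shift v \<in> gen_eigen V" if v: "v \<in> gen_eigen V" for v
  proof -
    obtain \<mu> m where "v \<in> V" "(sdiff \<mu> ^^ m) v = 0"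
      using v unfolding gen_eigen_def by blast
    hence "shift v \<in> V" "(sdiff \<mu> ^^ m) (shift v) = 0"
      by (auto simp: funpow_sdiff_shift shift_zero shift_mem)
    thus ?thesis unfolding gen_eigen_def by blast
  qed
  show "shift x \<in> rspan (gen_eigen V)" if "x \<in> rspan (gen_eigen V)" for x
    using that
    by (induction x rule: rspan.induct)
      (auto simp: shift_zero shift_add shift_rscale intro: rspan.intros *)
qed (auto intro: rspan_zero rspan_add rspan_scale)

text \<open>Write \<open>\<phi> = \<Sum>\<^sub>j c\<^sub>j (x - \<mu>)\<^sup>j\<close> and let \<open>c\<^sub>e\<close> be its first nonzero coefficient. If
  \<open>sdiff \<mu> w \<in> G\<close>, then \<open>u = \<Sum>\<^sub>j\<^sub>\<ge>\<^sub>e sdiff\<^sup>j\<^sup>-\<^sup>e w c\<^sub>j\<close> is a generalized eigenvector, for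
  \<open>sdiff\<^sup>e u\<close> is the image of \<open>w\<close> under \<open>\<phi>\<close>; and \<open>u\<close> agrees with \<open>w c\<^sub>e\<close> modulo \<open>G\<close>.\<close>

theorem gen_eigen_span:
  fixes V :: "(nat \<Rightarrow> 'a::division_ring) set"
  assumes V: "shift_space V"
    and central: "\<And>s. Poly_Mapping.lookup \<phi> s \<in> ring_center"
    and monic: "cmonic \<phi>"
    and factors: "product_of_linear_factors \<phi>"
    and kill: "\<And>v. v \<in> V \<Longrightarrow> act v \<phi> = 0"
  shows "V = rspan (gen_eigen V)"
proof
  interpret shift_space V by fact
  define G where "G = rspan (gen_eigen V)"
  interpret G: shift_space G
    unfolding G_def by (rule shift_space_gen_eigen) fact
  show "rspan (gen_eigen V) \<subseteq> V"
    by (rule rspan_subset_space) (auto simp: gen_eigen_def)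
  have "V \<subseteq> G"
  proof (rule ccontr)
    assume "\<not> V \<subseteq> G"
    then obtain w0 where w0: "w0 \<in> V" "w0 \<notin> G"
      by blast
    obtain ls where ls: "\<forall>l\<in>set ls. cdeg l = 1" "\<phi> = prod_list ls"
      using factors by (auto simp: product_of_linear_factors_def)
    have "act w0 (prod_list ls) \<in> G"
      using kill[OF w0(1)] ls G.zero_mem by simp
    then obtain w \<mu> where w: "w \<in> V" "w \<notin> G" "sdiff \<mu> w \<in> G"
      using exists_eigenvector_modulo[OF V G.shift_space_axioms ls(1) w0] by blast
    define N where "N = cdeg \<phi>"
    define f where "f = Poly_Mapping.lookup \<phi>"
    define c where "c = (\<lambda>j. \<Sum>s\<le>N. of_nat (s choose j) * \<mu> ^ (s - j) * f s)"
    have f: "f s * x = x * f s" for s x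
      using central[of s] by (auto simp: ring_center_def f_def)
    have nat_left: "x * (of_nat b * y) = of_nat b * (x * y)" for x y :: 'a and b
      using mult_of_nat_commute[of b x] by (simp flip: mult.assoc)
    have pow_left: "\<mu> ^ m * (\<mu> * y) = \<mu> * (\<mu> ^ m * y)" for m y
      using power_commutes[of \<mu> m] by (simp flip: mult.assoc)
    \<comment> \<open>The \<open>c j\<close> need not be central, but being polynomials in \<open>\<mu>\<close> with central coefficients they
      commute with \<open>\<mu>\<close>, so that multiplication by them commutes with \<open>sdiff \<mu>\<close>.\<close>
    have c_comm: "\<mu> * c j = c j * \<mu>" for j
      unfolding c_def sum_distrib_left sum_distrib_right
      by (intro sum.cong refl)
        (simp add: mult.assoc f nat_left pow_left)
    have taylor: "(\<Sum>j\<le>N. (sdiff \<mu> ^^ j) w \<star> c j) = 0"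
    proof
      fix k
      have "0 = act w \<phi> k"
        using kill[OF w(1)] by (simp add: seq_apply)
      also have "\<dots> = (\<Sum>s\<le>N. w (k + s) * f s)"
        by (simp add: act_eq_sum_atMost f_def N_def)
      also have "\<dots> = (\<Sum>s\<le>N. \<Sum>j\<le>s. of_nat (s choose j) * ((sdiff \<mu> ^^ j) w k * \<mu> ^ (s - j)) * f s)"
        by (subst shift_binomial[of w _ _ \<mu>]) (simp add: sum_distrib_right)
      also have "\<dots> = (\<Sum>s\<le>N. \<Sum>j\<le>N. of_nat (s choose j) * ((sdiff \<mu> ^^ j) w k * \<mu> ^ (s - j)) * f s)"
        by (intro sum.cong refl sum.mono_neutral_left) (auto simp: binomial_eq_0)
      also have "\<dots> = (\<Sum>j\<le>N. \<Sum>s\<le>N. of_nat (s choose j) * ((sdiff \<mu> ^^ j) w k * \<mu> ^ (s - j)) * f s)"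
        by (rule sum.swap)
      also have "\<dots> = (\<Sum>j\<le>N. (sdiff \<mu> ^^ j) w k * c j)"
        unfolding c_def sum_distrib_left
        by (simp add: mult.assoc nat_left)
      finally show "(\<Sum>j\<le>N. (sdiff \<mu> ^^ j) w \<star> c j) k = 0 k"
        by (simp add: seq_apply)
    qed
    have "c N = (\<Sum>s\<le>N. if s = N then f s else 0)"
      unfolding c_def by (intro sum.cong refl) (auto simp: binomial_eq_0)
    also have "\<dots> = 1"
      using monic by (simp add: cmonic_def N_def f_def)
    finally have cN: "c N \<noteq> 0" by simp
    define e where "e = (LEAST j. c j \<noteq> 0)"
    have less_e: "c j = 0" if "j < e" for j
      using LeastI[of "\<lambda>j. c j \<noteq> 0", OF cN] Least_le[of "\<lambda>j. c j \<noteq> 0", OF cN]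
        not_less_Least[of j "\<lambda>j. c j \<noteq> 0"] that
      unfolding e_def by auto
    have ce: "c e \<noteq> 0" and eN: "e \<le> N"
      using LeastI[of "\<lambda>j. c j \<noteq> 0", OF cN] Least_le[of "\<lambda>j. c j \<noteq> 0", OF cN]
      unfolding e_def by auto
    define u where "u = (\<Sum>j\<in>{e..N}. (sdiff \<mu> ^^ (j - e)) w \<star> c j)"
    have "(sdiff \<mu> ^^ e) u = (\<Sum>j\<in>{e..N}. (sdiff \<mu> ^^ j) w \<star> c j)"
      unfolding u_def funpow_sdiff_sum
    proof (intro sum.cong refl)
      fix j assume "j \<in> {e..N}"
      hence "(sdiff \<mu> ^^ e) ((sdiff \<mu> ^^ (j - e)) w) = (sdiff \<mu> ^^ j) w"
        by (simp flip: comp_apply[of "sdiff \<mu> ^^ e"] funpow_add)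
      thus "(sdiff \<mu> ^^ e) ((sdiff \<mu> ^^ (j - e)) w \<star> c j) = (sdiff \<mu> ^^ j) w \<star> c j"
        by (simp add: funpow_sdiff_rscale[OF c_comm])
    qed
    also have "\<dots> = (\<Sum>j\<le>N. (sdiff \<mu> ^^ j) w \<star> c j)"
      by (rule sum.mono_neutral_left) (auto simp: less_e)
    finally have "(sdiff \<mu> ^^ e) u = 0"
      using taylor by simp
    moreover have "u \<in> V"
      unfolding u_def by (intro sum_mem scale_mem funpow_sdiff_mem w)
    ultimately have u: "u \<in> G"
      unfolding G_def gen_eigen_def by (intro rspan_base) blast
    define r where "r = (\<Sum>j\<in>{Suc e..N}. (sdiff \<mu> ^^ (j - e)) w \<star> c j)"
    have r: "r \<in> G"
      unfolding r_def
    proof (intro G.sum_mem G.scale_mem)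
      fix j assume "j \<in> {Suc e..N}"
      then obtain i where "j - e = Suc i"
        by (metis Suc_diff_Suc Suc_le_lessD atLeastAtMost_iff)
      thus "(sdiff \<mu> ^^ (j - e)) w \<in> G"
        using G.funpow_sdiff_mem[OF w(3), of i \<mu>] by (simp only: funpow_Suc_right comp_apply)
    qed
    have "u = w \<star> c e + r"
      unfolding u_def r_def sum.atLeast_Suc_atMost[OF eN] by simp
    hence "w \<star> c e = u - r"
      by simp
    hence "w \<star> c e \<in> G"
      using G.diff_mem[OF u r] by simp
    hence "w \<star> c e \<star> inverse (c e) \<in> G"
      by (rule G.scale_mem)
    thus False
      using ce w(2) by (simp add: rscale_rscale)
  qed
  thus "V \<subseteq> rspan (gen_eigen V)"
    by (simp add: G_def)
qed

section \<open>Jordan chains\<close>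

text \<open>A triple \<open>(v, \<mu>, m)\<close> stands for the chain \<open>v, sdiff \<mu> v, \<dots>, sdiff\<^sup>m\<^sup>-\<^sup>1 \<mu> v\<close>, which is a
  Jordan chain with eigenvalue \<open>\<mu>\<close> in a space \<open>V\<close> if \<open>v \<in> V\<close> and \<open>sdiff\<^sup>m \<mu> v = 0\<close>.
  Degenerate chains of length 0 are allowed.\<close>

type_synonym 'a chain = "(nat \<Rightarrow> 'a) \<times> 'a \<times> nat"

abbreviation eig :: "'a chain \<Rightarrow> 'a" where "eig c \<equiv> fst (snd c)"

abbreviation len :: "'a chain \<Rightarrow> nat" where "len c \<equiv> snd (snd c)"

definition cvec :: "'a::ring_1 chain \<Rightarrow> nat \<Rightarrow> nat \<Rightarrow> 'a" where
  "cvec c j = (sdiff (eig c) ^^ j) (fst c)"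

definition chain_in :: "(nat \<Rightarrow> 'a::ring_1) set \<Rightarrow> 'a chain \<Rightarrow> bool" where
  "chain_in V c \<longleftrightarrow> fst c \<in> V \<and> cvec c (len c) = 0"

text \<open>All members of the chains in \<open>C\<close>.\<close>

definition chain_vecs :: "'a::ring_1 chain set \<Rightarrow> (nat \<Rightarrow> 'a) set" where
  "chain_vecs C = (\<Union>c\<in>C. cvec c ` {..<len c})"

text \<open>The span of the chains is only required to contain \<open>V\<close>; equality follows, as \<open>V\<close> will be
  a shift-invariant subspace.\<close>

definition spanning_chains :: "(nat \<Rightarrow> 'a::ring_1) set \<Rightarrow> 'a chain set \<Rightarrow> bool" where
  "spanning_chains V C \<longleftrightarrow> finite C \<and> (\<forall>c\<in>C. chain_in V c) \<and> V \<subseteq> rspan (chain_vecs C)"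

text \<open>A linear relation, indexed by positions in chains: equal members of different chains count as
  dependent.\<close>

definition chain_relation :: "'a::ring_1 chain set \<Rightarrow> ('a chain \<Rightarrow> nat \<Rightarrow> 'a) \<Rightarrow> bool" where
  "chain_relation C d \<longleftrightarrow> (\<Sum>c\<in>C. \<Sum>j<len c. cvec c j \<star> d c j) = 0"

lemma sdiff_cvec: "sdiff (eig c) (cvec c j) = cvec c (Suc j)"
  by (simp add: cvec_def)

lemma cvec_chain_vecs: "c \<in> C \<Longrightarrow> j < len c \<Longrightarrow> cvec c j \<in> chain_vecs C"
  by (auto simp: chain_vecs_def)

lemma exists_spanning_chains:
  fixes V :: "(nat \<Rightarrow> 'a::division_ring) set"
  assumes "V = rspan (gen_eigen V)" "finite B" "B \<subseteq> V" "V \<subseteq> rspan B"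
  shows "\<exists>C. spanning_chains V C"
proof -
  have "\<exists>E. finite E \<and> E \<subseteq> gen_eigen V \<and> b \<in> rspan E" if "b \<in> B" for b
  proof (rule rspan_finite_subset)
    show "b \<in> rspan (gen_eigen V)"
      using assms(3) that unfolding assms(1)[symmetric] by blast
  qed
  then obtain E where E: "\<And>b. b \<in> B \<Longrightarrow> finite (E b)" "\<And>b. b \<in> B \<Longrightarrow> E b \<subseteq> gen_eigen V"
    "\<And>b. b \<in> B \<Longrightarrow> b \<in> rspan (E b)"
    by metis
  define F where "F = \<Union>(E ` B)"
  have F: "finite F" "F \<subseteq> gen_eigen V"
    using E assms by (auto simp: F_def)
  have "B \<subseteq> rspan F"
  proof
    fix b assume b: "b \<in> B"
    hence "rspan (E b) \<subseteq> rspan F"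
      by (intro rspan_mono) (auto simp: F_def)
    thus "b \<in> rspan F"
      using E(3)[OF b] by blast
  qed
  hence VF: "V \<subseteq> rspan F"
    by (intro order_trans[OF assms(4) rspan_subset])
  have "\<forall>v\<in>F. \<exists>\<mu> m. v \<in> V \<and> (sdiff \<mu> ^^ m) v = 0"
    using F(2) unfolding gen_eigen_def by blast
  then obtain \<mu> m where \<mu>m: "\<And>v. v \<in> F \<Longrightarrow> v \<in> V \<and> (sdiff (\<mu> v) ^^ m v) v = 0"
    by metis
  define C where "C = (\<lambda>v. (v, \<mu> v, Suc (m v))) ` F"
  have "F \<subseteq> chain_vecs C"
  proof
    fix v assume "v \<in> F"
    moreover have "cvec (v, \<mu> v, Suc (m v)) 0 = v"
      by (simp add: cvec_def)
    ultimately show "v \<in> chain_vecs C"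
      using cvec_chain_vecs[of "(v, \<mu> v, Suc (m v))" C 0] by (auto simp: C_def)
  qed
  hence "V \<subseteq> rspan (chain_vecs C)"
    by (intro order_trans[OF VF rspan_mono])
  moreover have "chain_in V c" if "c \<in> C" for c
    using that \<mu>m by (auto simp: C_def chain_in_def cvec_def)
  ultimately show ?thesis
    using F(1) unfolding spanning_chains_def by (intro exI[of _ C]) (auto simp: C_def)
qed

text \<open>Coefficients of a relation after application of \<open>shift - (\<star> \<nu>)\<close>.\<close>

lemma chain_relation_shift:
  fixes V :: "(nat \<Rightarrow> 'a::division_ring) set"
  assumes "chain_relation C d" "\<And>c. c \<in> C \<Longrightarrow> chain_in V c"
  shows "chain_relation C (\<lambda>c j. eig c * d c j + (if j = 0 then 0 else d c (j - 1)) - d c j * \<nu>)"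
proof -
  let ?S = "\<Sum>c\<in>C. \<Sum>j<len c. cvec c j \<star> d c j"
  have S: "?S = 0"
    using assms(1) by (simp add: chain_relation_def)
  have *: "(\<Sum>j<len c. cvec c (Suc j) \<star> d c j) = (\<Sum>j<len c. cvec c j \<star> (if j = 0 then 0 else d c (j - 1)))"
    if "c \<in> C" for c
  proof (cases "len c")
    case (Suc n)
    have "cvec c (Suc n) = 0"
      using assms(2)[OF that] Suc by (simp add: chain_in_def)
    thus ?thesis
      unfolding Suc by (subst sum.lessThan_Suc_shift) simp
  qed simp
  have "0 = shift ?S - ?S \<star> \<nu>"
    unfolding S by (simp add: shift_zero)
  also have "shift ?S = (\<Sum>c\<in>C. \<Sum>j<len c. cvec c (Suc j) \<star> d c j + cvec c j \<star> (eig c * d c j))"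
    unfolding shift_sum shift_rscale
    by (intro sum.cong refl)
      (simp add: shift_eq_sdiff[of "cvec c j" "eig c" for c j] sdiff_cvec rscale_add_left rscale_rscale)
  also have "\<dots> = (\<Sum>c\<in>C. \<Sum>j<len c. cvec c j \<star> (if j = 0 then 0 else d c (j - 1)) + cvec c j \<star> (eig c * d c j))"
    by (rule sum.cong[OF refl]) (simp only: sum.distrib *)
  finally show ?thesis
    unfolding chain_relation_def
    by (simp add: rscale_sum_left rscale_rscale rscale_add_right rscale_diff_right
        sum_subtractf sum.distrib add.commute)
qed

text \<open>The element in position \<open>j\<close> of a chain \<open>c\<close> has height \<open>len c - j\<close>, so that eigenvectors have
  height 1. A nontrivial relation of least height, and with the fewest terms of that height, is
  itself an eigenvector for the shift.\<close>

lemma minimal_chain_relation: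
  fixes V :: "(nat \<Rightarrow> 'a::division_ring) set"
  assumes "finite C" "\<And>c. c \<in> C \<Longrightarrow> chain_in V c"
    and "chain_relation C d0" "c0 \<in> C" "j0 < len c0" "d0 c0 j0 \<noteq> 0"
  obtains d c1 j1 H where
    "chain_relation C d" "c1 \<in> C" "j1 < len c1" "d c1 j1 = 1" "len c1 - j1 = H"
    "\<And>c j. c \<in> C \<Longrightarrow> j < len c \<Longrightarrow> d c j \<noteq> 0 \<Longrightarrow> len c - j \<le> H"
    "\<And>c j. c \<in> C \<Longrightarrow> j < len c \<Longrightarrow>
       eig c * d c j + (if j = 0 then 0 else d c (j - 1)) = d c j * eig c1"
    "\<And>d' c j. chain_relation C d' \<Longrightarrow>
       (\<And>c j. c \<in> C \<Longrightarrow> j < len c \<Longrightarrow> d' c j \<noteq> 0 \<Longrightarrow> len c - j < H) \<Longrightarrow>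
       c \<in> C \<Longrightarrow> j < len c \<Longrightarrow> d' c j = 0"
proof -
  define low where "low = (\<lambda>H d. \<forall>c\<in>C. \<forall>j<len c. d c j \<noteq> (0::'a) \<longrightarrow> len c - j \<le> H)"
  define nz where "nz = (\<lambda>d. \<exists>c\<in>C. \<exists>j<len c. d c j \<noteq> (0::'a))"
  define P where "P = (\<lambda>H. \<exists>d. chain_relation C d \<and> nz d \<and> low H d)"
  define top where "top = (\<lambda>H d. {(c, j). c \<in> C \<and> j < len c \<and> len c - j = H \<and> d c j \<noteq> (0::'a)})"
  have "len c - j \<le> (\<Sum>c\<in>C. len c)" if "c \<in> C" for c j
    using member_le_sum[of c C len] that assms(1) by simp
  hence "P (\<Sum>c\<in>C. len c)"
    using assms(3-6) by (auto simp: P_def nz_def low_def)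
  hence PH: "P (LEAST H. P H)"
    by (rule LeastI)
  define H where "H = (LEAST H. P H)"
  define Q where "Q = (\<lambda>d. chain_relation C d \<and> nz d \<and> low H d)"
  obtain d1 where "Q d1"
    using PH by (auto simp: Q_def P_def H_def)
  define d2 where "d2 = (ARG_MIN (\<lambda>d. card (top H d)) d. Q d)"
  have d2: "Q d2" and least: "\<And>d. Q d \<Longrightarrow> card (top H d2) \<le> card (top H d)"
    using arg_min_nat_lemma[of Q d1 "\<lambda>d. card (top H d)"] \<open>Q d1\<close> by (auto simp: d2_def)
  have lower: "d' c j = 0" if d': "chain_relation C d'"
    "\<And>c j. c \<in> C \<Longrightarrow> j < len c \<Longrightarrow> d' c j \<noteq> 0 \<Longrightarrow> len c - j < H" "c \<in> C" "j < len c" for d' c j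
  proof (rule ccontr)
    assume nonzero: "d' c j \<noteq> 0"
    hence "H > 0"
      using d'(2)[OF d'(3,4)] by simp
    have "low (H - 1) d'"
      unfolding low_def using d'(2) by fastforce
    hence "P (H - 1)"
      unfolding P_def nz_def using d' nonzero by blast
    hence "H \<le> H - 1"
      unfolding H_def by (rule Least_le)
    thus False
      using \<open>H > 0\<close> by simp
  qed
  have fin: "finite (top H d)" for d
    by (rule finite_subset[of _ "SIGMA c:C. {..<len c}"]) (use assms(1) in \<open>auto simp: top_def\<close>)
  have "\<exists>c\<in>C. \<exists>j<len c. d2 c j \<noteq> 0 \<and> len c - j = H"
  proof (rule ccontr)
    assume *: "\<not> ?thesis"
    have "len c - j < H" if "c \<in> C" "j < len c" "d2 c j \<noteq> 0" for c j
    proof -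
      have "len c - j \<le> H"
        using that d2 unfolding Q_def low_def by blast
      moreover have "len c - j \<noteq> H"
        using * that by blast
      ultimately show ?thesis by simp
    qed
    hence "\<not> nz d2"
      using lower[of d2] d2 unfolding Q_def nz_def by blast
    thus False
      using d2 by (simp add: Q_def)
  qed
  then obtain c1 j1 where c1: "c1 \<in> C" "j1 < len c1" "d2 c1 j1 \<noteq> 0" "len c1 - j1 = H"
    by blast
  define d where "d = (\<lambda>c j. d2 c j * inverse (d2 c1 j1))"
  have d_iff: "d c j \<noteq> 0 \<longleftrightarrow> d2 c j \<noteq> 0" for c j
    using c1 by (simp add: d_def)
  have "(\<Sum>c\<in>C. \<Sum>j<len c. cvec c j \<star> d c j) =
      (\<Sum>c\<in>C. \<Sum>j<len c. cvec c j \<star> d2 c j) \<star> inverse (d2 c1 j1)"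
    by (simp add: rscale_sum_left rscale_rscale d_def)
  hence d: "chain_relation C d"
    using d2 by (simp add: chain_relation_def Q_def)
  have low: "low H d"
    using d2 d_iff by (simp add: Q_def low_def)
  \<comment> \<open>Normalized to have a coefficient 1 on top, \<open>d\<close> yields a relation without that term, and with
    no new ones of height \<open>H\<close>; by minimality it is trivial.\<close>
  define d' where "d' = (\<lambda>c j. eig c * d c j + (if j = 0 then 0 else d c (j - 1)) - d c j * eig c1)"
  have d': "chain_relation C d'"
    unfolding d'_def by (rule chain_relation_shift) (use d assms in auto)
  have top_pred: "d c (j - 1) = 0" if "c \<in> C" "j < len c" "j \<noteq> 0" "len c - j \<ge> H" for c j
  proof (rule ccontr)
    assume "d c (j - 1) \<noteq> 0"
    moreover have "j - 1 < len c"
      using that by simp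
    ultimately have "len c - (j - 1) \<le> H"
      using low that(1) unfolding low_def by blast
    thus False
      using that by linarith
  qed
  have d'_zero: "d' c j = 0" if "d c j = 0" "c \<in> C" "j < len c" "len c - j \<ge> H" for c j
    using that top_pred[of c j] by (simp add: d'_def)
  have "low H d'"
    unfolding low_def
  proof (intro ballI allI impI)
    fix c j assume *: "c \<in> C" "j < len c" "d' c j \<noteq> 0"
    show "len c - j \<le> H"
    proof (rule ccontr)
      assume "\<not> len c - j \<le> H"
      moreover from this have "d c j = 0"
        using low * unfolding low_def by blast
      ultimately show False
        using d'_zero[of c j] * by simp
    qed
  qed
  have "top H d' \<subseteq> top H d2"
    using d'_zero d_iff unfolding top_def by fastforce
  moreover have "d' c1 j1 = 0"
  proof -
    have "d c1 j1 = 1"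
      using c1 by (simp add: d_def)
    thus ?thesis
      using top_pred[of c1 j1] c1 by (simp add: d'_def)
  qed
  hence "(c1, j1) \<in> top H d2 - top H d'"
    using c1 by (simp add: top_def)
  ultimately have "card (top H d') < card (top H d2)"
    by (intro psubset_card_mono fin) auto
  hence "\<not> Q d'"
    using least[of d'] by auto
  hence "\<not> nz d'"
    using d' \<open>low H d'\<close> by (simp add: Q_def)
  hence eigen: "d' c j = 0" if "c \<in> C" "j < len c" for c j
    using that by (auto simp: nz_def)
  show thesis
  proof (rule that[of d c1 j1 H])
    show "d c1 j1 = 1"
      using c1 by (simp add: d_def)
    show "len c - j \<le> H" if "c \<in> C" "j < len c" "d c j \<noteq> 0" for c j
      using low that unfolding low_def by blast
    show "eig c * d c j + (if j = 0 then 0 else d c (j - 1)) = d c j * eig c1"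
      if "c \<in> C" "j < len c" for c j
      using eigen[OF that] unfolding d'_def by (simp only: right_minus_eq)
    show "d' c j = 0" if "chain_relation C d'"
      "\<And>c j. c \<in> C \<Longrightarrow> j < len c \<Longrightarrow> d' c j \<noteq> 0 \<Longrightarrow> len c - j < H"
      "c \<in> C" "j < len c" for d' c j
      using lower that by blast
  qed (fact d c1)+
qed

text \<open>If \<open>[e, \<mu>] = 1\<close>, then the commutator with \<open>e\<close> differentiates polynomials in \<open>\<mu>\<close>. In
  characteristic 0 this forces \<open>\<mu>\<close> to be transcendental over the center.\<close>

lemma unit_commutator_transcendental:
  fixes e \<mu> :: "'a::{division_ring, ring_char_0}"
  assumes e: "e * \<mu> = \<mu> * e + 1"
    and "\<And>s. f s \<in> ring_center" "(\<Sum>s\<le>N. f s * \<mu> ^ s) = 0" "s \<le> N"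
  shows "f s = 0"
  using assms(2-)
proof (induction N arbitrary: f s)
  case 0
  thus ?case by simp
next
  case (Suc N)
  have f: "f s * x = x * f s" for s x
    using Suc.prems(1)[of s] by (auto simp: ring_center_def)
  have pow: "e * \<mu> ^ s = \<mu> ^ s * e + of_nat s * \<mu> ^ (s - 1)" for s
  proof (induction s)
    case (Suc s)
    have "e * \<mu> ^ Suc s = (e * \<mu> ^ s) * \<mu>"
      by (simp add: power_Suc2 mult.assoc del: power_Suc)
    also have "\<dots> = \<mu> ^ s * (e * \<mu>) + of_nat s * (\<mu> ^ (s - 1) * \<mu>)"
      unfolding Suc by (simp add: algebra_simps)
    also have "of_nat s * (\<mu> ^ (s - 1) * \<mu>) = of_nat s * \<mu> ^ s"
      by (cases s) (simp_all add: power_commutes)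
    finally show ?case
      by (simp add: e power_Suc2 algebra_simps del: power_Suc)
  qed simp
  have comm: "e * (f s * \<mu> ^ s) = f s * \<mu> ^ s * e + f s * of_nat s * \<mu> ^ (s - 1)" for s
  proof -
    have "e * (f s * \<mu> ^ s) = f s * (e * \<mu> ^ s)"
      using f[of s e] by (simp flip: mult.assoc)
    thus ?thesis
      by (simp add: pow algebra_simps)
  qed
  have "0 = e * (\<Sum>s\<le>Suc N. f s * \<mu> ^ s) - (\<Sum>s\<le>Suc N. f s * \<mu> ^ s) * e"
    unfolding Suc.prems(2) by simp
  also have "\<dots> = (\<Sum>s\<le>Suc N. f s * of_nat s * \<mu> ^ (s - 1))"
    unfolding sum_distrib_left sum_distrib_right sum_subtractf[symmetric]
    by (intro sum.cong refl) (simp add: comm)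
  also have "\<dots> = (\<Sum>s\<le>N. f (Suc s) * of_nat (Suc s) * \<mu> ^ s)"
    by (subst sum.atMost_Suc_shift) simp
  finally have sum0: "(\<Sum>s\<le>N. f (Suc s) * of_nat (Suc s) * \<mu> ^ s) = 0"
    by simp
  have central: "f (Suc s) * of_nat (Suc s) \<in> ring_center" for s
    unfolding ring_center_def
  proof safe
    fix x
    have "f (Suc s) * of_nat (Suc s) * x = f (Suc s) * (x * of_nat (Suc s))"
      by (simp only: mult.assoc mult_of_nat_commute)
    also have "\<dots> = x * (f (Suc s) * of_nat (Suc s))"
      using f[of "Suc s" x] by (simp only: mult.assoc[symmetric])
    finally show "f (Suc s) * of_nat (Suc s) * x = x * (f (Suc s) * of_nat (Suc s))" .
  qed
  have fSuc: "f (Suc s) = 0" if "s \<le> N" for s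
    using Suc.IH[of "\<lambda>s. f (Suc s) * of_nat (Suc s)" s, OF central sum0 that]
    by (simp del: of_nat_Suc)
  have "f 0 = (\<Sum>s\<le>Suc N. f s * \<mu> ^ s)"
    by (subst sum.atMost_Suc_shift) (simp add: fSuc)
  hence "f 0 = 0"
    using Suc.prems(2) by simp
  thus ?case
    using fSuc Suc.prems(3) by (cases s) auto
qed

text \<open>A chain can be exchanged for a shorter one as long as the span is preserved.\<close>

lemma spanning_chains_replace:
  fixes V :: "(nat \<Rightarrow> 'a::division_ring) set"
  assumes "spanning_chains V C" "c0 \<in> C" "chain_in V c'" "len c' < len c0"
    and "\<And>j. j < len c0 \<Longrightarrow> cvec c0 j \<in> rspan (chain_vecs (insert c' (C - {c0})))"
  shows "\<exists>C'. spanning_chains V C' \<and> (\<Sum>c\<in>C'. len c) < (\<Sum>c\<in>C. len c)"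
proof -
  let ?C' = "insert c' (C - {c0})"
  have fin: "finite C"
    using assms(1) by (simp add: spanning_chains_def)
  have "chain_vecs C \<subseteq> rspan (chain_vecs ?C')"
  proof
    fix x assume "x \<in> chain_vecs C"
    then obtain c j where cj: "c \<in> C" "j < len c" "x = cvec c j"
      by (auto simp: chain_vecs_def)
    show "x \<in> rspan (chain_vecs ?C')"
    proof (cases "c = c0")
      case False
      thus ?thesis
        using cj by (auto intro!: rspan_base cvec_chain_vecs)
    qed (use cj assms(5) in auto)
  qed
  hence "spanning_chains V ?C'"
    using assms(1,3) rspan_subset[of "chain_vecs C" "chain_vecs ?C'"]
    unfolding spanning_chains_def by auto
  moreover have "(\<Sum>c\<in>?C'. len c) \<le> len c' + (\<Sum>c\<in>C - {c0}. len c)"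
    using fin by (simp add: sum.insert_if)
  hence "(\<Sum>c\<in>?C'. len c) < (\<Sum>c\<in>C. len c)"
    using assms(2,4) fin by (simp add: sum.remove[of C c0])
  ultimately show ?thesis by blast
qed

text \<open>Spanning chains of least total length are independent. A minimal relation of height at least
  2 contains an element \<open>e\<close> with \<open>[e, \<mu>] = 1\<close>, while \<open>\<phi>(\<mu>) = 0\<close>. A minimal relation of height 1,
  that is, between eigenvectors, has after rescaling a common eigenvalue; the aligned sum of the
  chains in it then shortens the shortest one of them.\<close>

theorem exists_independent_chains:
  fixes V :: "(nat \<Rightarrow> 'a::{division_ring, ring_char_0}) set"
  assumes V: "shift_space V"
    and B: "finite B" "B \<subseteq> V" "V \<subseteq> rspan B"
    and central: "\<And>s. Poly_Mapping.lookup \<phi> s \<in> ring_center"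
    and monic: "cmonic \<phi>"
    and factors: "product_of_linear_factors \<phi>"
    and kill: "\<And>v. v \<in> V \<Longrightarrow> act v \<phi> = 0"
  obtains C where "spanning_chains V C" "\<And>c. c \<in> C \<Longrightarrow> len c > 0"
    "\<And>d c j. chain_relation C d \<Longrightarrow> c \<in> C \<Longrightarrow> j < len c \<Longrightarrow> d c j = 0"
proof -
  interpret shift_space V by fact
  obtain C0 where "spanning_chains V C0"
    using exists_spanning_chains[OF gen_eigen_span[OF V central monic factors kill] B] by blast
  define C where "C = (ARG_MIN (\<lambda>C. \<Sum>c\<in>C. len c) C. spanning_chains V C)"
  have C: "spanning_chains V C"
    and least: "\<And>C'. spanning_chains V C' \<Longrightarrow> (\<Sum>c\<in>C. len c) \<le> (\<Sum>c\<in>C'. len c)"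
    using arg_min_nat_lemma[of "spanning_chains V" C0 "\<lambda>C. \<Sum>c\<in>C. len c"] \<open>spanning_chains V C0\<close>
    by (auto simp: C_def)
  have fin: "finite C" and in_V: "\<And>c. c \<in> C \<Longrightarrow> chain_in V c"
    using C by (auto simp: spanning_chains_def)
  have cvec_V: "cvec c j \<in> V" if "c \<in> C" for c j
    using in_V[OF that] unfolding chain_in_def cvec_def by (auto intro: funpow_sdiff_mem)
  have indep: "d0 c0 j0 = 0" if d0: "chain_relation C d0" "c0 \<in> C" "j0 < len c0" for d0 c0 j0
  proof (rule ccontr)
    assume "d0 c0 j0 \<noteq> 0"
    obtain d c1 j1 H where
      d: "chain_relation C d" and c1: "c1 \<in> C" "j1 < len c1" "d c1 j1 = 1" "len c1 - j1 = H" and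
      height: "\<And>c j. c \<in> C \<Longrightarrow> j < len c \<Longrightarrow> d c j \<noteq> 0 \<Longrightarrow> len c - j \<le> H" and
      eigen: "\<And>c j. c \<in> C \<Longrightarrow> j < len c \<Longrightarrow>
         eig c * d c j + (if j = 0 then 0 else d c (j - 1)) = d c j * eig c1" and
      lower: "\<And>d' c j. chain_relation C d' \<Longrightarrow>
         (\<And>c j. c \<in> C \<Longrightarrow> j < len c \<Longrightarrow> d' c j \<noteq> 0 \<Longrightarrow> len c - j < H) \<Longrightarrow>
         c \<in> C \<Longrightarrow> j < len c \<Longrightarrow> d' c j = 0"
      using minimal_chain_relation[OF fin in_V d0 \<open>d0 c0 j0 \<noteq> 0\<close>] by blast
    define \<mu> where "\<mu> = eig c1"
    consider "H = 1" | "H \<ge> 2"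
      using c1 by linarith
    thus False
    proof cases
      case 2
      \<comment> \<open>The eigenvalue equation of \<open>d\<close>, one position below its top coefficient 1.\<close>
      have j1: "Suc j1 < len c1"
        using 2 c1 by linarith
      define e where "e = d c1 (Suc j1)"
      have e: "e * \<mu> = \<mu> * e + 1"
        using eigen[OF c1(1) j1] c1(3) by (simp add: e_def \<mu>_def)
      define b where "b = cvec c1 (len c1 - 1)"
      have "b \<noteq> 0"
      proof
        assume "b = 0"
        define d' where "d' = (\<lambda>c j. if c = c1 \<and> j = len c1 - 1 then 1 else (0::'a))"
        have "(\<Sum>j<len c. cvec c j \<star> d' c j) = 0" for c
          by (rule sum.neutral) (use \<open>b = 0\<close> in \<open>auto simp: d'_def b_def\<close>)
        hence "chain_relation C d'"
          by (simp add: chain_relation_def)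
        hence "d' c1 (len c1 - 1) = 0"
          by (rule lower) (use 2 c1 in \<open>auto simp: d'_def split: if_splits\<close>)
        thus False by (simp add: d'_def)
      qed
      have "sdiff \<mu> b = cvec c1 (len c1)"
        using sdiff_cvec[of c1 "len c1 - 1"] c1 by (simp add: b_def \<mu>_def)
      hence "sdiff \<mu> b = 0"
        using in_V[OF c1(1)] by (simp add: chain_in_def)
      hence b: "b k = b 0 * \<mu> ^ k" for k
        unfolding sdiff_eq_0_iff by blast
      have "b 0 \<noteq> 0"
      proof
        assume "b 0 = 0"
        have "b = 0"
        proof
          fix k
          show "b k = 0 k"
            using b[of k] \<open>b 0 = 0\<close> by (simp add: seq_apply)
        qed
        thus False using \<open>b \<noteq> 0\<close> by simp
      qed
      have "b s * Poly_Mapping.lookup \<phi> s = b 0 * (Poly_Mapping.lookup \<phi> s * \<mu> ^ s)" for s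
        using central[of s] unfolding ring_center_def by (subst b) (simp add: mult.assoc)
      moreover have "(\<Sum>s\<le>cdeg \<phi>. b s * Poly_Mapping.lookup \<phi> s) = 0"
        using fun_cong[OF kill[of b], of 0] cvec_V[OF c1(1), of "len c1 - 1"]
        by (simp add: act_eq_sum_atMost b_def seq_apply)
      ultimately have "b 0 * (\<Sum>s\<le>cdeg \<phi>. Poly_Mapping.lookup \<phi> s * \<mu> ^ s) = 0"
        by (simp add: sum_distrib_left)
      hence "(\<Sum>s\<le>cdeg \<phi>. Poly_Mapping.lookup \<phi> s * \<mu> ^ s) = 0"
        using \<open>b 0 \<noteq> 0\<close> by simp
      hence "Poly_Mapping.lookup \<phi> (cdeg \<phi>) = 0"
        using unit_commutator_transcendental[where f = "Poly_Mapping.lookup \<phi>", OF e central] by simp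
      thus False
        using monic by (simp add: cmonic_def)
    next
      case 1
      define C1 where "C1 = {c \<in> C. len c > 0 \<and> d c (len c - 1) \<noteq> 0}"
      define a where "a = (\<lambda>c. d c (len c - 1))"
      have "j1 = len c1 - 1"
        using c1 1 by linarith
      hence C1: "finite C1" "C1 \<subseteq> C" "c1 \<in> C1"
        using fin c1 by (auto simp: C1_def)
      have a_eig: "eig c * a c = a c * \<mu>" if "c \<in> C1" for c
      proof -
        have "len c > 0" "c \<in> C"
          using that by (auto simp: C1_def)
        moreover have "d c (len c - 1 - 1) = 0" if "len c - 1 \<noteq> 0"
        proof (rule ccontr)
          assume "d c (len c - 1 - 1) \<noteq> 0"
          hence "len c - (len c - 1 - 1) \<le> 1"
            using height[of c "len c - 1 - 1"] \<open>c \<in> C\<close> that 1 by simp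
          thus False
            using that by linarith
        qed
        ultimately show ?thesis
          using eigen[of c "len c - 1"] by (auto simp: a_def \<mu>_def split: if_splits)
      qed
      have "(\<Sum>j<len c. cvec c j \<star> d c j) = (if c \<in> C1 then cvec c (len c - 1) \<star> a c else 0)"
        if "c \<in> C" for c
      proof -
        have "(\<Sum>j<len c. cvec c j \<star> d c j) =
            (\<Sum>j<len c. if j = len c - 1 then cvec c (len c - 1) \<star> a c else 0)"
        proof (intro sum.cong refl)
          fix j assume j: "j \<in> {..<len c}"
          have "d c j = 0" if "j \<noteq> len c - 1"
          proof (rule ccontr)
            assume "d c j \<noteq> 0"
            hence "len c - j \<le> 1"
              using height[of c j] \<open>c \<in> C\<close> j 1 by simp
            thus False
              using that j by simp
          qed
          thus "cvec c j \<star> d c j = (if j = len c - 1 then cvec c (len c - 1) \<star> a c else 0)"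
            by (simp add: a_def)
        qed
        thus ?thesis
          using that by (auto simp: C1_def a_def)
      qed
      hence "(\<Sum>c\<in>C. \<Sum>j<len c. cvec c j \<star> d c j) = (\<Sum>c\<in>C1. cvec c (len c - 1) \<star> a c)"
        using fin C1 by (simp add: sum.If_cases Int_absorb1)
      hence bottom: "(\<Sum>c\<in>C1. cvec c (len c - 1) \<star> a c) = 0"
        using d by (simp add: chain_relation_def)
      define m where "m = Min (len ` C1)"
      have "m \<in> len ` C1"
        unfolding m_def using C1 by (intro Min_in) auto
      then obtain c2 where c2: "c2 \<in> C1" "len c2 = m"
        by auto
      have m_le: "m \<le> len c" if "c \<in> C1" for c
        using that C1 by (simp add: m_def)
      have "m > 0"
        using c2 by (auto simp: C1_def)
      \<comment> \<open>Rescaled by \<open>a\<close>, all chains in the relation have eigenvalue \<open>\<mu>\<close>. Their sum, aligned at the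
        eigenvectors, is a chain of length \<open>m\<close> whose last member is 0.\<close>
      define v where "v = (\<Sum>c\<in>C1. cvec c (len c - m) \<star> a c)"
      define c' where "c' = (v, \<mu>, m - 1)"
      have v: "cvec c' j = (\<Sum>c\<in>C1. cvec c (len c - m + j) \<star> a c)" for j
        unfolding cvec_def c'_def v_def fst_conv snd_conv funpow_sdiff_sum
        by (intro sum.cong refl)
          (simp add: funpow_sdiff_rscale[OF a_eig] add.commute[of _ j] funpow_add)
      have last: "cvec c' (m - 1) = 0"
      proof -
        have "cvec c' (m - 1) = (\<Sum>c\<in>C1. cvec c (len c - 1) \<star> a c)"
          unfolding v using m_le \<open>m > 0\<close> by (intro sum.cong refl) (simp add: Suc_diff_le)
        thus ?thesis using bottom by simp
      qed
      have "v \<in> V"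
        unfolding v_def using C1 by (intro sum_mem scale_mem cvec_V) auto
      hence "chain_in V c'"
        using last by (simp add: chain_in_def c'_def)
      moreover have "cvec c2 j \<in> rspan (chain_vecs (insert c' (C - {c2})))" if "j < len c2" for j
      proof -
        let ?S = "chain_vecs (insert c' (C - {c2}))"
        have "cvec c' j \<in> rspan ?S"
        proof (cases "j = m - 1")
          case True
          thus ?thesis by (simp only: last rspan_zero)
        next
          case False
          hence "j < len c'"
            using that c2 by (simp add: c'_def)
          thus ?thesis by (auto intro!: rspan_base cvec_chain_vecs)
        qed
        moreover define r where "r = (\<Sum>c\<in>C1 - {c2}. cvec c (len c - m + j) \<star> a c)"
        have "r \<in> rspan ?S"
          unfolding r_def
        proof (intro rspan_sum rspan_scaled_base cvec_chain_vecs)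
          fix c assume c: "c \<in> C1 - {c2}"
          thus "c \<in> insert c' (C - {c2})"
            using C1 by auto
          show "len c - m + j < len c"
            using that c2 m_le[of c] c by simp
        qed
        ultimately have "cvec c' j - r \<in> rspan ?S"
          by (intro rspan_diff)
        hence "(cvec c' j - r) \<star> inverse (a c2) \<in> rspan ?S"
          by (rule rspan_scale)
        moreover have "cvec c' j = cvec c2 j \<star> a c2 + r"
          unfolding v r_def sum.remove[OF C1(1) c2(1)] using c2(2) by simp
        moreover have "a c2 \<noteq> 0"
          using c2 by (simp add: C1_def a_def)
        ultimately show ?thesis
          by (simp add: rscale_rscale)
      qed
      moreover have "len c' < len c2"
        using c2 \<open>m > 0\<close> by (simp add: c'_def)
      ultimately obtain C' where "spanning_chains V C'" "(\<Sum>c\<in>C'. len c) < (\<Sum>c\<in>C. len c)"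
        using spanning_chains_replace[OF C, of c2 c'] c2(1) C1(2) by blast
      thus False
        using least[of C'] by simp
    qed
  qed
  define D where "D = {c \<in> C. len c > 0}"
  have "chain_vecs D = chain_vecs C"
    by (auto simp: chain_vecs_def D_def)
  hence D: "spanning_chains V D"
    using C by (auto simp: spanning_chains_def D_def)
  have indep_D: "d c j = 0" if "chain_relation D d" "c \<in> D" "j < len c" for d c j
  proof -
    have "(\<Sum>c\<in>D. \<Sum>j<len c. cvec c j \<star> d c j) = (\<Sum>c\<in>C. \<Sum>j<len c. cvec c j \<star> d c j)"
      by (rule sum.mono_neutral_left) (auto simp: D_def fin)
    hence "chain_relation C d"
      using that by (simp add: chain_relation_def)
    thus ?thesis
      using indep that by (auto simp: D_def)
  qed
  show thesis
  proof (rule that[OF D])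
    show "len c > 0" if "c \<in> D" for c
      using that by (simp add: D_def)
  qed (fact indep_D)
qed

text \<open>A basis that consists of \<open>t\<close> Jordan chains with distinct eigenvalues \<open>lam i\<close> and lengths
  \<open>m i\<close>. The \<open>i\<close>-th chain starts from \<open>v i\<close> and ends in the geometric sequence of ratio
  \<open>lam i\<close>.\<close>

definition jordan_basis :: "(nat \<Rightarrow> 'a::ring_1) set \<Rightarrow> nat \<Rightarrow> (nat \<Rightarrow> nat \<Rightarrow> 'a) \<Rightarrow> (nat \<Rightarrow> 'a) \<Rightarrow>
    (nat \<Rightarrow> nat) \<Rightarrow> bool" where
  "jordan_basis V t v lam m \<longleftrightarrow>
     inj_on lam {1..t} \<and>
     (\<forall>i\<in>{1..t}. m i > 0 \<and> v i \<in> V \<and> (sdiff (lam i) ^^ m i) (v i) = 0 \<and>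
        (\<forall>k. (sdiff (lam i) ^^ (m i - 1)) (v i) k = lam i ^ k)) \<and>
     (\<forall>x\<in>V. \<exists>d. x = (\<Sum>i=1..t. \<Sum>q<m i. (sdiff (lam i) ^^ q) (v i) \<star> d i q)) \<and>
     (\<forall>d. (\<Sum>i=1..t. \<Sum>q<m i. (sdiff (lam i) ^^ q) (v i) \<star> d i q) = 0 \<longrightarrow>
        (\<forall>i\<in>{1..t}. \<forall>q<m i. d i q = 0))"

text \<open>Rescaling a chain so that its eigenvector becomes \<open>(\<lambda>\<^sup>k)\<^sub>k\<close> conjugates its eigenvalue. The new
  eigenvalues are distinct, because the eigenvectors are independent.\<close>

theorem exists_jordan_basis:
  fixes V :: "(nat \<Rightarrow> 'a::{division_ring, ring_char_0}) set"
  assumes V: "shift_space V"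
    and B: "finite B" "B \<subseteq> V" "V \<subseteq> rspan B"
    and central: "\<And>s. Poly_Mapping.lookup \<phi> s \<in> ring_center"
    and monic: "cmonic \<phi>"
    and factors: "product_of_linear_factors \<phi>"
    and kill: "\<And>v. v \<in> V \<Longrightarrow> act v \<phi> = 0"
  shows "\<exists>t v lam m. jordan_basis V t v lam m"
proof -
  obtain C where C: "spanning_chains V C" and len: "\<And>c. c \<in> C \<Longrightarrow> len c > 0"
    and indep: "\<And>d c j. chain_relation C d \<Longrightarrow> c \<in> C \<Longrightarrow> j < len c \<Longrightarrow> d c j = 0"
    using exists_independent_chains[OF V B central monic factors kill] by metis
  have fin: "finite C" and in_V: "\<And>c. c \<in> C \<Longrightarrow> chain_in V c"
    and span: "V \<subseteq> rspan (chain_vecs C)"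
    using C by (auto simp: spanning_chains_def)
  define u where "u = (\<lambda>c::'a chain. cvec c (len c - 1) 0)"
  have bottom: "cvec c (len c - 1) k = u c * eig c ^ k" if "c \<in> C" for c k
  proof -
    have "sdiff (eig c) (cvec c (len c - 1)) = 0"
      using in_V[OF that] len[OF that] by (simp add: sdiff_cvec chain_in_def)
    thus ?thesis
      unfolding sdiff_eq_0_iff u_def by blast
  qed
  have bottom_indep: "a c = 0" if rel: "(\<Sum>c\<in>C. cvec c (len c - 1) \<star> a c) = 0" and c: "c \<in> C" for a c
  proof -
    define d where "d = (\<lambda>c j. if j = len c - 1 then a c else 0)"
    have "(\<Sum>j<len c. cvec c j \<star> d c j) = cvec c (len c - 1) \<star> a c" if "c \<in> C" for c
    proof -
      have "(\<Sum>j<len c. cvec c j \<star> d c j) =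
          (\<Sum>j<len c. if j = len c - 1 then cvec c (len c - 1) \<star> a c else 0)"
        by (rule sum.cong) (auto simp: d_def)
      thus ?thesis
        using len[OF that] by simp
    qed
    hence "chain_relation C d"
      using rel by (simp add: chain_relation_def)
    hence "d c (len c - 1) = 0"
      by (rule indep) (use len[OF c] c in auto)
    thus ?thesis by (simp add: d_def)
  qed
  have u: "u c \<noteq> 0" if c: "c \<in> C" for c
  proof
    assume "u c = 0"
    hence "cvec c (len c - 1) = 0"
      using bottom[OF c] by (simp add: fun_eq_iff seq_apply)
    hence "(\<Sum>c'\<in>C. cvec c' (len c' - 1) \<star> (if c' = c then 1 else 0)) = 0"
      by (intro sum.neutral) auto
    from bottom_indep[OF this c] show False by simp
  qed
  define \<Lambda> where "\<Lambda> = (\<lambda>c::'a chain. u c * eig c * inverse (u c))"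
  define w where "w = (\<lambda>c::'a chain. fst c \<star> inverse (u c))"
  have w: "(sdiff (\<Lambda> c) ^^ q) (w c) = cvec c q \<star> inverse (u c)" if "c \<in> C" for c q
  proof -
    have "eig c * inverse (u c) = inverse (u c) * \<Lambda> c"
      using u[OF that] by (simp add: \<Lambda>_def mult.assoc[symmetric])
    thus ?thesis
      unfolding w_def cvec_def by (rule funpow_sdiff_rscale)
  qed
  have pow: "u c * eig c ^ k * inverse (u c) = \<Lambda> c ^ k" if "c \<in> C" for c k
  proof (induction k)
    case (Suc k)
    have "\<Lambda> c ^ Suc k = (u c * eig c ^ k * inverse (u c)) * (u c * eig c * inverse (u c))"
      unfolding Suc by (simp add: \<Lambda>_def power_Suc2 del: power_Suc)
    also have "\<dots> = u c * eig c ^ k * (inverse (u c) * u c) * eig c * inverse (u c)"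
      by (simp only: mult.assoc)
    also have "\<dots> = u c * eig c ^ Suc k * inverse (u c)"
      using u[OF that] by (simp add: power_Suc2 mult.assoc del: power_Suc)
    finally show ?case ..
  qed (use u[OF that] in simp)
  have inj: "inj_on \<Lambda> C"
  proof (rule inj_onI, rule ccontr)
    fix c c' assume c: "c \<in> C" "c' \<in> C" "\<Lambda> c = \<Lambda> c'" "c \<noteq> c'"
    define a where "a = (\<lambda>x. if x = c then inverse (u c) else if x = c' then - inverse (u c') else 0)"
    have "(\<Sum>x\<in>C. cvec x (len x - 1) \<star> a x) = (\<Sum>x\<in>{c, c'}. cvec x (len x - 1) \<star> a x)"
      by (rule sum.mono_neutral_right) (use fin c in \<open>auto simp: a_def\<close>)
    also have "\<dots> = cvec c (len c - 1) \<star> inverse (u c) + cvec c' (len c' - 1) \<star> (- inverse (u c'))"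
      using c by (simp add: a_def)
    also have "\<dots> = 0"
    proof
      fix k
      show "(cvec c (len c - 1) \<star> inverse (u c) + cvec c' (len c' - 1) \<star> (- inverse (u c'))) k = 0 k"
        using pow[OF c(1), of k] pow[OF c(2), of k] c(3)
        by (simp add: seq_apply bottom[OF c(1)] bottom[OF c(2)] del: One_nat_def)
    qed
    finally have "a c = 0"
      by (rule bottom_indep) (fact c)
    thus False
      using u[OF c(1)] by (simp add: a_def)
  qed
  \<comment> \<open>It remains to number the chains.\<close>
  define t where "t = card C"
  obtain h where h: "bij_betw h {1..t} C"
    using ex_bij_betw_nat_finite_1[OF fin] by (auto simp: t_def)
  define g where "g = the_inv_into {1..t} h"
  have hC: "h i \<in> C" if "i \<in> {1..t}" for i
    using h that by (auto simp: bij_betw_def)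
  have gh: "g (h i) = i" if "i \<in> {1..t}" for i
    using h that by (simp add: g_def bij_betw_def the_inv_into_f_f)
  have reindex: "(\<Sum>i=1..t. \<Sum>q<len (h i). cvec (h i) q \<star> f (h i) q) = (\<Sum>c\<in>C. \<Sum>q<len c. cvec c q \<star> f c q)" for f
    by (rule sum.reindex_bij_betw[OF h])
  have "jordan_basis V t (\<lambda>i. w (h i)) (\<lambda>i. \<Lambda> (h i)) (\<lambda>i. len (h i))"
    unfolding jordan_basis_def
  proof (intro conjI ballI allI impI)
    have "inj_on (\<Lambda> \<circ> h) {1..t}"
      by (rule comp_inj_on) (use h inj in \<open>auto simp: bij_betw_def\<close>)
    thus "inj_on (\<lambda>i. \<Lambda> (h i)) {1..t}"
      by (simp add: comp_def)
  next
    fix i assume i: "i \<in> {1..t}"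
    note c = hC[OF i]
    show "len (h i) > 0"
      by (rule len[OF c])
    show "w (h i) \<in> V"
      unfolding w_def using in_V[OF c] shift_space.scale_mem[OF V] by (simp add: chain_in_def)
    show "(sdiff (\<Lambda> (h i)) ^^ len (h i)) (w (h i)) = 0"
      unfolding w[OF c] using in_V[OF c] by (simp add: chain_in_def)
    show "(sdiff (\<Lambda> (h i)) ^^ (len (h i) - 1)) (w (h i)) k = \<Lambda> (h i) ^ k" for k
      unfolding w[OF c] rscale_apply bottom[OF c] by (rule pow[OF c])
  next
    fix x assume "x \<in> V"
    define I where "I = (SIGMA c:C. {..<len c})"
    have "chain_vecs C = (\<lambda>(c, j). cvec c j) ` I"
      by (auto simp: chain_vecs_def I_def image_iff)
    moreover have "x \<in> rspan (chain_vecs C)"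
      using \<open>x \<in> V\<close> span by auto
    moreover have "finite I"
      using fin by (simp add: I_def)
    ultimately obtain d where "x = (\<Sum>z\<in>I. (\<lambda>(c, j). cvec c j) z \<star> d z)"
      using rspan_image_sum by metis
    also have "\<dots> = (\<Sum>(c, j)\<in>I. cvec c j \<star> d (c, j))"
      by (rule sum.cong) auto
    also have "\<dots> = (\<Sum>c\<in>C. \<Sum>j<len c. cvec c j \<star> d (c, j))"
      unfolding I_def by (rule sum.Sigma[symmetric]) (use fin in auto)
    also have "\<dots> = (\<Sum>i=1..t. \<Sum>q<len (h i). cvec (h i) q \<star> d (h i, q))"
      by (rule reindex[symmetric])
    also have "\<dots> = (\<Sum>i=1..t. \<Sum>q<len (h i). (sdiff (\<Lambda> (h i)) ^^ q) (w (h i)) \<star> (u (h i) * d (h i, q)))"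
    proof (intro sum.cong refl)
      fix i q assume "i \<in> {1..t}"
      note c = hC[OF this]
      show "cvec (h i) q \<star> d (h i, q) = (sdiff (\<Lambda> (h i)) ^^ q) (w (h i)) \<star> (u (h i) * d (h i, q))"
        unfolding w[OF c] rscale_rscale using u[OF c] by (simp add: mult.assoc[symmetric])
    qed
    finally show "\<exists>d. x = (\<Sum>i=1..t. \<Sum>q<len (h i). (sdiff (\<Lambda> (h i)) ^^ q) (w (h i)) \<star> d i q)"
      by (rule exI[of _ "\<lambda>i q. u (h i) * d (h i, q)"])
  next
    fix d i q
    assume rel: "(\<Sum>i=1..t. \<Sum>q<len (h i). (sdiff (\<Lambda> (h i)) ^^ q) (w (h i)) \<star> d i q) = 0"
      and i: "i \<in> {1..t}" and q: "q < len (h i)"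
    have "(\<Sum>c\<in>C. \<Sum>q<len c. cvec c q \<star> (inverse (u c) * d (g c) q)) =
        (\<Sum>i=1..t. \<Sum>q<len (h i). cvec (h i) q \<star> (inverse (u (h i)) * d (g (h i)) q))"
      by (rule reindex[symmetric])
    also have "\<dots> = (\<Sum>i=1..t. \<Sum>q<len (h i). (sdiff (\<Lambda> (h i)) ^^ q) (w (h i)) \<star> d i q)"
      by (intro sum.cong refl) (simp add: w[OF hC] gh rscale_rscale)
    finally have "chain_relation C (\<lambda>c q. inverse (u c) * d (g c) q)"
      unfolding rel chain_relation_def .
    from indep[OF this hC[OF i] q] show "d i q = 0"
      using u[OF hC[OF i]] gh[OF i] by simp
  qed
  thus ?thesis by blast
qed

section \<open>Polynomials times exponentials\<close>

text \<open>Functions on the natural numbers that are given by a polynomial of degree less than \<open>m\<close> with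
  coefficients on the left.\<close>

definition polynomial_fun :: "nat \<Rightarrow> (nat \<Rightarrow> 'a::ring_1) \<Rightarrow> bool" where
  "polynomial_fun m f \<longleftrightarrow> (\<exists>d. \<forall>k. f k = (\<Sum>s<m. d s * of_nat k ^ s))"

lemma polynomial_fun_mono:
  assumes "polynomial_fun m f" "m \<le> m'"
  shows "polynomial_fun m' f"
proof -
  obtain d where d: "\<And>k. f k = (\<Sum>s<m. d s * of_nat k ^ s)"
    using assms(1) by (auto simp: polynomial_fun_def)
  have "f k = (\<Sum>s<m'. (if s < m then d s else 0) * of_nat k ^ s)" for k
    unfolding d by (rule sum.mono_neutral_cong_left) (use assms(2) in auto)
  thus ?thesis
    unfolding polynomial_fun_def by (intro exI[of _ "\<lambda>s. if s < m then d s else 0"] allI)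
qed

lemma polynomial_fun_sum:
  assumes "\<And>i. i \<in> A \<Longrightarrow> polynomial_fun m (f i)"
  shows "polynomial_fun m (\<lambda>k. \<Sum>i\<in>A. f i k)"
proof -
  have "\<forall>i\<in>A. \<exists>d. \<forall>k. f i k = (\<Sum>s<m. d s * of_nat k ^ s)"
    using assms by (simp add: polynomial_fun_def)
  then obtain d where d: "\<forall>i\<in>A. \<forall>k. f i k = (\<Sum>s<m. d i s * of_nat k ^ s)"
    by metis
  have "(\<Sum>i\<in>A. f i k) = (\<Sum>s<m. (\<Sum>i\<in>A. d i s) * of_nat k ^ s)" for k
  proof -
    have "(\<Sum>i\<in>A. f i k) = (\<Sum>i\<in>A. \<Sum>s<m. d i s * of_nat k ^ s)"
      using d by simp
    also have "\<dots> = (\<Sum>s<m. \<Sum>i\<in>A. d i s * of_nat k ^ s)"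
      by (rule sum.swap)
    finally show ?thesis
      by (simp add: sum_distrib_right)
  qed
  thus ?thesis
    unfolding polynomial_fun_def by (intro exI[of _ "\<lambda>s. \<Sum>i\<in>A. d i s"] allI)
qed

lemma polynomial_fun_binomial:
  fixes w :: "'a::{division_ring, ring_char_0}"
  shows "polynomial_fun (Suc r) (\<lambda>k. w * of_nat (k choose r))"
proof (induction r arbitrary: w)
  case 0
  show ?case
    unfolding polynomial_fun_def by (rule exI[of _ "\<lambda>_. w"]) simp
next
  case (Suc r)
  define w' where "w' = w * inverse (of_nat (Suc r))"
  obtain d where d: "\<And>k. w' * of_nat (k choose r) = (\<Sum>s<Suc r. d s * of_nat k ^ s)"
    using Suc[of w'] unfolding polynomial_fun_def by blast
  define d' where "d' = (\<lambda>s. (if s = 0 then 0 else d (s - 1)) - (if s < Suc r then d s * of_nat r else 0))"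
  have "w * of_nat (k choose Suc r) = (\<Sum>s<Suc (Suc r). d' s * of_nat k ^ s)" for k
  proof -
    \<comment> \<open>Over the natural numbers this holds for \<open>k < r\<close> as well, both sides being 0.\<close>
    have "Suc r * (k choose Suc r) = (k - r) * (k choose r)"
      by (simp only: binomial_absorption binomial_absorb_comp)
    hence "of_nat (Suc r) * of_nat (k choose Suc r) = (of_nat ((k - r) * (k choose r)) :: 'a)"
      by (metis of_nat_mult)
    also have "\<dots> = of_nat (k choose r) * (of_nat k - of_nat r)"
    proof (cases "k < r")
      case False
      thus ?thesis
        by (simp add: of_nat_diff mult_of_nat_commute)
    qed simp
    finally have *: "of_nat (Suc r) * of_nat (k choose Suc r) =
        (of_nat (k choose r) * (of_nat k - of_nat r) :: 'a)" .
    have "w = w' * of_nat (Suc r)"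
      by (simp add: w'_def mult.assoc del: of_nat_Suc)
    hence "w * of_nat (k choose Suc r) = w' * (of_nat (Suc r) * of_nat (k choose Suc r))"
      by (simp only: mult.assoc)
    also have "\<dots> = (\<Sum>s<Suc r. d s * of_nat k ^ s) * (of_nat k - of_nat r)"
      unfolding * d[symmetric] by (simp only: mult.assoc)
    also have "\<dots> = (\<Sum>s<Suc r. d s * of_nat k ^ Suc s) - (\<Sum>s<Suc r. d s * of_nat r * of_nat k ^ s)"
    proof -
      have "of_nat k ^ s * (of_nat r :: 'a) = of_nat r * of_nat k ^ s" for s
        by (rule mult_of_nat_commute[symmetric])
      thus ?thesis
        unfolding right_diff_distrib sum_distrib_right
        by (simp only: mult.assoc power_Suc2)
    qed
    also have "(\<Sum>s<Suc r. d s * of_nat k ^ Suc s) =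
        (\<Sum>s<Suc (Suc r). (if s = 0 then 0 else d (s - 1)) * of_nat k ^ s)"
      by (subst (2) sum.lessThan_Suc_shift) (simp del: sum.lessThan_Suc power_Suc)
    also have "(\<Sum>s<Suc r. d s * of_nat r * of_nat k ^ s) =
        (\<Sum>s<Suc (Suc r). (if s < Suc r then d s * of_nat r else 0) * of_nat k ^ s)"
      by (rule sum.mono_neutral_cong_left) auto
    finally show ?thesis
      by (simp only: d'_def left_diff_distrib sum_subtractf)
  qed
  thus ?case
    unfolding polynomial_fun_def by (intro exI[of _ d'] allI)
qed

lemma polynomial_fun_ceval:
  fixes f :: "nat \<Rightarrow> 'a::ring_1"
  assumes "polynomial_fun m f" "m > 0"
  shows "\<exists>p. cdeg p < m \<and> (\<forall>k. f k = ceval p (of_nat k))"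
proof -
  obtain d where d: "\<And>k. f k = (\<Sum>s<m. d s * of_nat k ^ s)"
    using assms(1) by (auto simp: polynomial_fun_def)
  define p where "p = (\<Sum>s<m. Poly_Mapping.single s (d s))"
  have lookup: "Poly_Mapping.lookup p s = (if s < m then d s else 0)" for s
    by (simp add: p_def lookup_sum lookup_single when_def)
  have "ceval p x = (\<Sum>s<m. d s * x ^ s)" for x
    unfolding ceval_def
    by (rule sum.mono_neutral_cong_left) (auto simp: lookup in_keys_iff split: if_splits)
  moreover have "cdeg p < m"
  proof (cases "Poly_Mapping.degree p = 0")
    case True
    thus ?thesis
      using assms(2) by (simp add: cdeg_def)
  next
    case False
    hence "cdeg p \<in> Poly_Mapping.keys p"
      using degree_greater_zero_in_keys[of p] unfolding cdeg_def by blast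
    thus ?thesis
      by (auto simp: in_keys_iff lookup split: if_splits)
  qed
  ultimately show ?thesis
    using d by auto
qed

text \<open>Newton's expansion: \<open>v k = \<Sum>\<^sub>j (k choose j) (sdiff\<^sup>j v 0) \<mu>\<^sup>k\<^sup>-\<^sup>j\<close>, where the terms with
  \<open>j \<ge> m\<close> vanish and \<open>\<mu>\<^sup>k\<^sup>-\<^sup>j = \<mu>\<^sup>-\<^sup>j \<mu>\<^sup>k\<close>.\<close>

lemma gen_eigen_polynomial_exponential:
  fixes v :: "nat \<Rightarrow> 'a::{division_ring, ring_char_0}"
  assumes "(sdiff \<mu> ^^ m) v = 0" "\<mu> \<noteq> 0" "m > 0"
  shows "\<exists>p. cdeg p < m \<and> (\<forall>k. v k = ceval p (of_nat k) * \<mu> ^ k)"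
proof -
  define w where "w = (\<lambda>j. (sdiff \<mu> ^^ j) v 0 * inverse \<mu> ^ j)"
  have vanish: "(sdiff \<mu> ^^ j) v = 0" if "j \<ge> m" for j
  proof -
    have "(sdiff \<mu> ^^ j) v = (sdiff \<mu> ^^ (j - m)) ((sdiff \<mu> ^^ m) v)"
      using that by (simp flip: comp_apply[of "sdiff \<mu> ^^ (j - m)"] funpow_add)
    thus ?thesis
      by (simp add: assms(1))
  qed
  have v: "v k = (\<Sum>j<m. w j * of_nat (k choose j)) * \<mu> ^ k" for k
  proof -
    have "v k = (\<Sum>j\<le>k. of_nat (k choose j) * ((sdiff \<mu> ^^ j) v 0 * \<mu> ^ (k - j)))"
      using shift_binomial[of v 0 k \<mu>] by simp
    also have "\<dots> = (\<Sum>j\<le>k. w j * of_nat (k choose j) * \<mu> ^ k)"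
    proof (intro sum.cong refl)
      fix j assume "j \<in> {..k}"
      hence "\<mu> ^ k = \<mu> ^ j * \<mu> ^ (k - j)"
        by (simp flip: power_add)
      hence "\<mu> ^ (k - j) = inverse \<mu> ^ j * \<mu> ^ k"
        using assms(2) by (simp add: power_inverse mult.assoc[symmetric])
      hence "of_nat (k choose j) * ((sdiff \<mu> ^^ j) v 0 * \<mu> ^ (k - j)) =
          of_nat (k choose j) * w j * \<mu> ^ k"
        by (simp only: w_def mult.assoc)
      thus "of_nat (k choose j) * ((sdiff \<mu> ^^ j) v 0 * \<mu> ^ (k - j)) =
          w j * of_nat (k choose j) * \<mu> ^ k"
        by (simp only: mult_of_nat_commute)
    qed
    also have "\<dots> = (\<Sum>j<max m (Suc k). w j * of_nat (k choose j) * \<mu> ^ k)"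
      by (rule sum.mono_neutral_left) (auto simp: binomial_eq_0)
    also have "\<dots> = (\<Sum>j<m. w j * of_nat (k choose j) * \<mu> ^ k)"
      by (rule sum.mono_neutral_right) (auto simp: w_def vanish seq_apply)
    finally show ?thesis
      by (simp add: sum_distrib_right)
  qed
  have "polynomial_fun m (\<lambda>k. \<Sum>j<m. w j * of_nat (k choose j))"
    by (intro polynomial_fun_sum polynomial_fun_mono[OF polynomial_fun_binomial]) auto
  then obtain p where "cdeg p < m" "\<And>k. (\<Sum>j<m. w j * of_nat (k choose j)) = ceval p (of_nat k)"
    using polynomial_fun_ceval[OF _ assms(3)] by blast
  thus ?thesis
    using v by auto
qed

section \<open>The solution space of a linear recurrence\<close>

text \<open>The solutions of the recurrence for all initial values.\<close>

definition rec_space :: "nat \<Rightarrow> (nat \<Rightarrow> 'a::ring_1) \<Rightarrow> (nat \<Rightarrow> 'a) set" where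
  "rec_space n c = {a. \<forall>k. a (k + n) = - (\<Sum>i<n. c i * a (k + i))}"

lemma solves_recurrence_iff:
  "solves_recurrence n c init a \<longleftrightarrow> a \<in> rec_space n c \<and> (\<forall>i<n. a i = init i)"
  by (auto simp: solves_recurrence_def rec_space_def)

lemma shift_space_rec_space: "shift_space (rec_space n c)"
proof
  show "0 \<in> rec_space n c"
    by (simp add: rec_space_def seq_apply)
next
  fix v w assume "v \<in> rec_space n c" "w \<in> rec_space n c"
  thus "v + w \<in> rec_space n c"
    by (simp add: rec_space_def seq_apply distrib_left sum.distrib)
next
  fix v d assume "v \<in> rec_space n c"
  thus "v \<star> d \<in> rec_space n c"
    by (simp add: rec_space_def seq_apply sum_distrib_right mult.assoc)
next
  fix v assume v: "v \<in> rec_space n c"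
  have "v (Suc k + n) = - (\<Sum>i<n. c i * v (Suc k + i))" for k
    using v unfolding rec_space_def by blast
  thus "shift v \<in> rec_space n c"
    by (simp add: rec_space_def seq_apply)
qed

lemma rec_space_eqI:
  assumes "a \<in> rec_space n c" "b \<in> rec_space n c" "\<And>i. i < n \<Longrightarrow> a i = b i"
  shows "a = b"
proof
  fix k show "a k = b k"
  proof (induction k rule: less_induct)
    case (less k)
    show ?case
    proof (cases "k < n")
      case False
      define r where "r = k - n"
      have k: "k = r + n"
        using False by (simp add: r_def)
      have "a k = - (\<Sum>i<n. c i * a (r + i))" "b k = - (\<Sum>i<n. c i * b (r + i))"
        using assms(1,2) unfolding k rec_space_def by blast+
      moreover have "a (r + i) = b (r + i)" if "i < n" for i
        using that by (intro less) (simp add: k)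
      ultimately show ?thesis by simp
    qed (use assms(3) in auto)
  qed
qed

text \<open>The solution with given initial values.\<close>

function rec_solution :: "nat \<Rightarrow> (nat \<Rightarrow> 'a::ring_1) \<Rightarrow> (nat \<Rightarrow> 'a) \<Rightarrow> nat \<Rightarrow> 'a" where
  "rec_solution n c init k =
     (if k < n then init k else - (\<Sum>i<n. c i * rec_solution n c init (k - n + i)))"
  by auto
termination by (relation "Wellfounded.measure (\<lambda>(n, c, init, k). k)") auto

declare rec_solution.simps [simp del]

lemma rec_solution_mem: "rec_solution n c init \<in> rec_space n c"
  unfolding rec_space_def
proof safe
  fix k
  show "rec_solution n c init (k + n) = - (\<Sum>i<n. c i * rec_solution n c init (k + i))"
    by (subst rec_solution.simps) simp
qed

lemma rec_solution_init: "i < n \<Longrightarrow> rec_solution n c init i = init i"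
  by (subst rec_solution.simps) simp

text \<open>The solutions whose initial values are the unit vectors.\<close>

definition rec_unit :: "nat \<Rightarrow> (nat \<Rightarrow> 'a::ring_1) \<Rightarrow> nat \<Rightarrow> nat \<Rightarrow> 'a" where
  "rec_unit n c l = rec_solution n c (\<lambda>i. if i = l then 1 else 0)"

lemma rec_unit_mem: "rec_unit n c l \<in> rec_space n c"
  by (simp add: rec_unit_def rec_solution_mem)

lemma rec_unit_apply: "i < n \<Longrightarrow> rec_unit n c l i = (if i = l then 1 else 0)"
  by (simp add: rec_unit_def rec_solution_init)

lemma rec_unit_combination_apply:
  assumes "i < n"
  shows "(\<Sum>l<n. rec_unit n c l \<star> d l) i = d i"
proof -
  have "(\<Sum>l<n. rec_unit n c l \<star> d l) i = (\<Sum>l<n. if l = i then d i else 0)"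
    unfolding sum_fun_apply using assms by (intro sum.cong) (auto simp: seq_apply rec_unit_apply)
  thus ?thesis
    using assms by simp
qed

lemma rec_unit_combination:
  assumes "x \<in> rec_space n c"
  shows "x = (\<Sum>l<n. rec_unit n c l \<star> x l)"
proof (rule rec_space_eqI[OF assms])
  interpret shift_space "rec_space n c"
    by (rule shift_space_rec_space)
  show "(\<Sum>l<n. rec_unit n c l \<star> x l) \<in> rec_space n c"
    by (intro sum_mem scale_mem rec_unit_mem)
qed (simp add: rec_unit_combination_apply)

lemma rec_space_subset_rspan: "rec_space n c \<subseteq> rspan (rec_unit n c ` {..<n})"
proof
  fix x assume "x \<in> rec_space n c"
  hence "x = (\<Sum>l<n. rec_unit n c l \<star> x l)"
    by (rule rec_unit_combination)
  moreover have "(\<Sum>l<n. rec_unit n c l \<star> x l) \<in> rspan (rec_unit n c ` {..<n})"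
    by (intro rspan_sum rspan_scaled_base) auto
  ultimately show "x \<in> rspan (rec_unit n c ` {..<n})"
    by simp
qed

lemma recurrence_companion_carrier: "recurrence_companion n c \<in> carrier_mat n n"
  by (simp add: recurrence_companion_def)

lemma companion_mult_window:
  assumes "a \<in> rec_space n c"
  shows "recurrence_companion n c *\<^sub>v vec n (\<lambda>i. a (k + i)) = vec n (\<lambda>i. a (Suc k + i))"
proof (rule eq_vecI)
  fix i assume "i < dim_vec (vec n (\<lambda>i. a (Suc k + i)))"
  hence i: "i < n" by simp
  have "(recurrence_companion n c *\<^sub>v vec n (\<lambda>i. a (k + i))) $ i =
      (\<Sum>j<n. (if i + 1 = n then - c j else if j = i + 1 then 1 else 0) * a (k + j))"
    using i by (simp add: recurrence_companion_def scalar_prod_def atLeast0LessThan)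
  also have "\<dots> = a (Suc k + i)"
  proof (cases "i + 1 = n")
    case True
    have "a (k + n) = - (\<Sum>j<n. c j * a (k + j))"
      using assms unfolding rec_space_def by blast
    moreover have "Suc k + i = k + n"
      using True by simp
    ultimately have "a (Suc k + i) = - (\<Sum>j<n. c j * a (k + j))"
      by (simp only:)
    thus ?thesis
      using True by (simp add: sum_negf)
  next
    case False
    have "(\<Sum>j<n. (if i + 1 = n then - c j else if j = i + 1 then 1 else 0) * a (k + j)) =
        (\<Sum>j<n. if j = i + 1 then a (k + (i + 1)) else 0)"
      using False by (intro sum.cong) auto
    thus ?thesis
      using False i by simp
  qed
  finally show "(recurrence_companion n c *\<^sub>v vec n (\<lambda>i. a (k + i))) $ i = vec n (\<lambda>i. a (Suc k + i)) $ i"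
    using i by simp
qed (simp add: recurrence_companion_def)

lemma companion_pow_mult_window:
  assumes "a \<in> rec_space n c"
  shows "(recurrence_companion n c ^\<^sub>m s) *\<^sub>v vec n (\<lambda>i. a (k + i)) = vec n (\<lambda>i. a (k + s + i))"
proof (induction s arbitrary: k)
  case 0
  show ?case
    using recurrence_companion_carrier[of n c] by simp
next
  case (Suc s)
  note A = recurrence_companion_carrier[of n c]
  have "(recurrence_companion n c ^\<^sub>m Suc s) *\<^sub>v vec n (\<lambda>i. a (k + i)) =
      (recurrence_companion n c ^\<^sub>m s) *\<^sub>v (recurrence_companion n c *\<^sub>v vec n (\<lambda>i. a (k + i)))"
    unfolding pow_mat.simps by (rule assoc_mult_mat_vec[OF pow_carrier_mat[OF A] A]) simp
  also have "\<dots> = (recurrence_companion n c ^\<^sub>m s) *\<^sub>v vec n (\<lambda>i. a (Suc k + i))"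
    by (simp only: companion_mult_window[OF assms])
  finally show ?case
    unfolding Suc by simp
qed

text \<open>A central polynomial that annihilates the companion matrix annihilates all solutions: read
  off the top row of its value at the companion matrix.\<close>

lemma act_center_annihilator:
  fixes c :: "nat \<Rightarrow> 'a::ring_1"
  assumes ann: "center_annihilator (recurrence_companion n c) \<phi>" and "n \<ge> 1"
    and a: "a \<in> rec_space n c"
  shows "act a \<phi> = 0"
proof
  fix k
  define A where "A = recurrence_companion n c"
  have A: "A \<in> carrier_mat n n"
    unfolding A_def by (rule recurrence_companion_carrier)
  let ?f = "Poly_Mapping.lookup \<phi>"
  have row: "(\<Sum>s\<in>Poly_Mapping.keys \<phi>. ?f s * (A ^\<^sub>m s) $$ (0, l)) = 0" if "l < n" for l
  proof -
    have "ceval_mat \<phi> A $$ (0, l) = 0"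
      using ann that A by (simp add: center_annihilator_def flip: A_def)
    moreover have "ceval_mat \<phi> A $$ (0, l) =
        (\<Sum>s\<in>Poly_Mapping.keys \<phi>. ?f s * (A ^\<^sub>m s) $$ (0, l))"
      unfolding ceval_mat_def using that A pow_carrier_mat[OF A] by (simp add: index_smult_mat)
    ultimately show ?thesis by simp
  qed
  have window: "a (k + s) = (\<Sum>l<n. (A ^\<^sub>m s) $$ (0, l) * a (k + l))" for s
  proof -
    have "a (k + s) = ((A ^\<^sub>m s) *\<^sub>v vec n (\<lambda>i. a (k + i))) $ 0"
      unfolding A_def companion_pow_mult_window[OF a] using \<open>n \<ge> 1\<close> by simp
    also have "\<dots> = (\<Sum>l<n. (A ^\<^sub>m s) $$ (0, l) * a (k + l))"
      using \<open>n \<ge> 1\<close> carrier_matD[OF pow_carrier_mat[OF A, of s]] by (simp add: scalar_prod_def atLeast0LessThan)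
    finally show ?thesis .
  qed
  have "act a \<phi> k = (\<Sum>s\<in>Poly_Mapping.keys \<phi>. ?f s * a (k + s))"
    using ann by (simp add: act_def center_annihilator_def ring_center_def)
  also have "\<dots> = (\<Sum>s\<in>Poly_Mapping.keys \<phi>. \<Sum>l<n. ?f s * (A ^\<^sub>m s) $$ (0, l) * a (k + l))"
    by (intro sum.cong refl) (subst window, simp only: sum_distrib_left mult.assoc)
  also have "\<dots> = (\<Sum>l<n. \<Sum>s\<in>Poly_Mapping.keys \<phi>. ?f s * (A ^\<^sub>m s) $$ (0, l) * a (k + l))"
    by (rule sum.swap)
  also have "\<dots> = (\<Sum>l<n. (\<Sum>s\<in>Poly_Mapping.keys \<phi>. ?f s * (A ^\<^sub>m s) $$ (0, l)) * a (k + l))"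
    by (simp only: sum_distrib_right)
  also have "\<dots> = 0"
    by (rule sum.neutral) (use row in auto)
  finally show "act a \<phi> k = 0 k"
    by (simp add: seq_apply)
qed

lemma left_eigenvalue_companion:
  assumes "(\<lambda>k. \<mu> ^ k) \<in> rec_space n c" "n \<ge> 1"
  shows "left_eigenvalue (recurrence_companion n c) (\<mu> :: 'a::ring_1)"
proof -
  let ?v = "vec n (\<lambda>i. \<mu> ^ (0 + i))"
  have "recurrence_companion n c *\<^sub>v ?v = vec n (\<lambda>i. \<mu> ^ (Suc 0 + i))"
    by (rule companion_mult_window[OF assms(1)])
  also have "\<dots> = \<mu> \<cdot>\<^sub>v ?v"
    by (rule eq_vecI) auto
  finally have "recurrence_companion n c *\<^sub>v ?v = \<mu> \<cdot>\<^sub>v ?v" .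
  moreover have "?v \<noteq> 0\<^sub>v n"
  proof
    assume "?v = 0\<^sub>v n"
    hence "?v $ 0 = (0\<^sub>v n :: 'a vec) $ 0"
      by simp
    thus False
      using assms(2) by simp
  qed
  ultimately show ?thesis
    unfolding left_eigenvalue_def
    by (intro bexI[of _ ?v]) (auto simp: recurrence_companion_def)
qed

lemma power_rec_space_nonzero:
  assumes "(\<lambda>k. \<mu> ^ k) \<in> rec_space n c" "n \<ge> 1" "c 0 \<noteq> 0"
  shows "\<mu> \<noteq> (0 :: 'a::ring_1)"
proof
  assume \<mu>: "\<mu> = 0"
  have "\<mu> ^ (0 + n) = - (\<Sum>i<n. c i * \<mu> ^ (0 + i))"
    using assms(1) unfolding rec_space_def by blast
  also have "(\<Sum>i<n. c i * \<mu> ^ (0 + i)) = (\<Sum>i<n. if i = 0 then c 0 else 0)"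
    by (rule sum.cong) (auto simp: \<mu> power_0_left)
  finally show False
    using assms(2,3) \<mu> by (simp add: power_0_left)
qed

section \<open>Dimension over a division ring\<close>

text \<open>Fewer equations than unknowns, by Gaussian elimination: \<open>p\<close> below is the pivot of the last
  equation, and \<open>A'\<close> the system after elimination of the unknown \<open>p\<close>.\<close>

lemma homogeneous_system_solution:
  fixes A :: "nat \<Rightarrow> 'i \<Rightarrow> 'a::division_ring"
  assumes "finite J" "card J > r"
  shows "\<exists>x. (\<exists>j\<in>J. x j \<noteq> 0) \<and> (\<forall>i<r. (\<Sum>j\<in>J. A i j * x j) = 0)"
  using assms
proof (induction r arbitrary: J A)
  case 0
  hence "J \<noteq> {}" by auto
  thus ?case by (intro exI[of _ "\<lambda>_. 1"]) auto
next
  case (Suc r)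
  show ?case
  proof (cases "\<exists>p\<in>J. A r p \<noteq> 0")
    case False
    obtain x where x: "\<exists>j\<in>J. x j \<noteq> 0" "\<forall>i<r. (\<Sum>j\<in>J. A i j * x j) = 0"
      using Suc.IH[of J A] Suc.prems by auto
    moreover have "(\<Sum>j\<in>J. A r j * x j) = 0"
      using False by (intro sum.neutral) auto
    ultimately show ?thesis
      by (auto simp: less_Suc_eq)
  next
    case True
    then obtain p where p: "p \<in> J" "A r p \<noteq> 0" by blast
    define J' where "J' = J - {p}"
    define A' where "A' = (\<lambda>i j. A i j - A i p * (inverse (A r p) * A r j))"
    have "finite J'" "card J' > r"
      using Suc.prems p by (auto simp: J'_def)
    then obtain x where x: "\<exists>j\<in>J'. x j \<noteq> 0" "\<And>i. i < r \<Longrightarrow> (\<Sum>j\<in>J'. A' i j * x j) = 0"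
      using Suc.IH[of J' A'] by auto
    define z where "z = (\<Sum>j\<in>J'. A r j * x j)"
    define y where "y = x(p := - (inverse (A r p) * z))"
    have y: "(\<Sum>j\<in>J. A i j * y j) = (\<Sum>j\<in>J'. A i j * x j) - A i p * (inverse (A r p) * z)" for i
    proof -
      have "(\<Sum>j\<in>J. A i j * y j) = A i p * y p + (\<Sum>j\<in>J'. A i j * y j)"
        unfolding J'_def by (rule sum.remove) (use p Suc.prems in auto)
      also have "(\<Sum>j\<in>J'. A i j * y j) = (\<Sum>j\<in>J'. A i j * x j)"
        by (rule sum.cong) (auto simp: y_def J'_def)
      finally show ?thesis
        by (simp add: y_def)
    qed
    have "(\<Sum>j\<in>J. A i j * y j) = 0" if "i < Suc r" for i
    proof (cases "i = r")
      case True
      thus ?thesis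
        unfolding y using p by (simp add: z_def mult.assoc[symmetric])
    next
      case False
      hence "0 = (\<Sum>j\<in>J'. A' i j * x j)"
        using x(2)[of i] that by simp
      also have "\<dots> = (\<Sum>j\<in>J'. A i j * x j) - A i p * (inverse (A r p) * z)"
        by (simp add: A'_def z_def left_diff_distrib sum_subtractf sum_distrib_left mult.assoc)
      finally show ?thesis
        unfolding y by simp
    qed
    moreover have "\<exists>j\<in>J. y j \<noteq> 0"
      using x(1) by (auto simp: y_def J'_def)
    ultimately show ?thesis by blast
  qed
qed

lemma rec_space_basis_card:
  fixes c :: "nat \<Rightarrow> 'a::division_ring"
  assumes "finite J" and mem: "\<And>j. j \<in> J \<Longrightarrow> S j \<in> rec_space n c"
    and span: "\<And>x. x \<in> rec_space n c \<Longrightarrow> \<exists>d. x = (\<Sum>j\<in>J. S j \<star> d j)"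
    and indep: "\<And>d j. (\<Sum>j\<in>J. S j \<star> d j) = 0 \<Longrightarrow> j \<in> J \<Longrightarrow> d j = 0"
  shows "card J = n"
proof (rule antisym)
  interpret shift_space "rec_space n c"
    by (rule shift_space_rec_space)
  show "card J \<le> n"
  proof (rule ccontr)
    assume "\<not> card J \<le> n"
    then obtain x where x: "\<exists>j\<in>J. x j \<noteq> 0" "\<forall>i<n. (\<Sum>j\<in>J. S j i * x j) = 0"
      using homogeneous_system_solution[of J n "\<lambda>i j. S j i"] assms(1) by auto
    have "(\<Sum>j\<in>J. S j \<star> x j) = 0"
    proof (rule rec_space_eqI)
      show "(\<Sum>j\<in>J. S j \<star> x j) \<in> rec_space n c"
        by (intro sum_mem scale_mem mem)
      show "(\<Sum>j\<in>J. S j \<star> x j) i = 0 i" if "i < n" for i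
        using x(2) that by (simp add: seq_apply)
    qed (rule zero_mem)
    thus False
      using indep x(1) by blast
  qed
  show "n \<le> card J"
  proof (rule ccontr)
    assume less: "\<not> n \<le> card J"
    have "\<forall>l. \<exists>d. rec_unit n c l = (\<Sum>j\<in>J. S j \<star> d j)"
      using span rec_unit_mem by blast
    then obtain W where W: "\<And>l. rec_unit n c l = (\<Sum>j\<in>J. S j \<star> W l j)"
      by metis
    obtain h where h: "bij_betw h {0..<card J} J"
      using ex_bij_betw_nat_finite[OF assms(1)] by blast
    have "card J < card {..<n}"
      using less by simp
    then obtain x where x: "\<exists>l\<in>{..<n}. x l \<noteq> 0"
      "\<And>i. i < card J \<Longrightarrow> (\<Sum>l<n. W l (h i) * x l) = 0"
      using homogeneous_system_solution[of "{..<n}" "card J" "\<lambda>i l. W l (h i)"] by blast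
    have W0: "(\<Sum>l<n. W l j * x l) = 0" if "j \<in> J" for j
    proof -
      have "j \<in> h ` {0..<card J}"
        using that h by (simp add: bij_betw_def)
      then obtain i where "i < card J" "j = h i"
        by auto
      thus ?thesis
        using x(2) by simp
    qed
    have "(\<Sum>l<n. rec_unit n c l \<star> x l) = (\<Sum>l<n. \<Sum>j\<in>J. S j \<star> (W l j * x l))"
      by (simp only: W rscale_sum_left rscale_rscale)
    also have "\<dots> = (\<Sum>j\<in>J. \<Sum>l<n. S j \<star> (W l j * x l))"
      by (rule sum.swap)
    also have "\<dots> = (\<Sum>j\<in>J. S j \<star> (\<Sum>l<n. W l j * x l))"
      by (simp only: rscale_sum_right)
    also have "\<dots> = 0"
      by (rule sum.neutral) (simp add: W0)
    finally have "x l = 0" if "l < n" for l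
      using rec_unit_combination_apply[OF that, of c x] by (simp add: seq_apply)
    thus False
      using x(1) by auto
  qed
qed

text \<open>The change of basis between the unit solutions and a basis \<open>S\<close>, as a pair of mutually
  inverse matrices; \<open>U\<close> has the initial segments of the basis as its columns.\<close>

lemma rec_space_basis_matrices:
  fixes c :: "nat \<Rightarrow> 'a::division_ring"
  assumes mem: "\<And>j. j \<in> {1..n} \<Longrightarrow> S j \<in> rec_space n c"
    and span: "\<And>x. x \<in> rec_space n c \<Longrightarrow> \<exists>d. x = (\<Sum>j=1..n. S j \<star> d j)"
    and indep: "\<And>d j. (\<Sum>j=1..n. S j \<star> d j) = 0 \<Longrightarrow> j \<in> {1..n} \<Longrightarrow> d j = 0"
  shows "\<exists>U W. U \<in> carrier_mat n n \<and> W \<in> carrier_mat n n \<and> inverts_mat U W \<and> inverts_mat W U \<and>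
    (\<forall>init. (\<Sum>j=1..n. S j \<star> ((W *\<^sub>v vec n init) $ (j - 1))) = rec_solution n c init)"
proof -
  interpret shift_space "rec_space n c"
    by (rule shift_space_rec_space)
  have "\<forall>l. \<exists>d. rec_unit n c l = (\<Sum>j=1..n. S j \<star> d j)"
    using span rec_unit_mem by blast
  then obtain w' where w': "\<And>l. rec_unit n c l = (\<Sum>j=1..n. S j \<star> w' l j)"
    by metis
  define w where "w = (\<lambda>j l. w' l j)"
  have w: "rec_unit n c l = (\<Sum>j=1..n. S j \<star> w j l)" for l
    unfolding w_def by (rule w')
  have combination: "(\<Sum>l<n. rec_unit n c l \<star> d l) = (\<Sum>j=1..n. S j \<star> (\<Sum>l<n. w j l * d l))" for d
  proof -
    have "(\<Sum>l<n. rec_unit n c l \<star> d l) = (\<Sum>l<n. \<Sum>j=1..n. S j \<star> (w j l * d l))"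
      by (simp only: w rscale_sum_left rscale_rscale)
    also have "\<dots> = (\<Sum>j=1..n. \<Sum>l<n. S j \<star> (w j l * d l))"
      by (rule sum.swap)
    finally show ?thesis
      by (simp only: rscale_sum_right)
  qed
  define U where "U = mat n n (\<lambda>(k, j). S (Suc j) k)"
  define W where "W = mat n n (\<lambda>(j, l). w (Suc j) l)"
  have shift_index: "(\<Sum>j<n. f (Suc j)) = (\<Sum>j=1..n. f j)" for f :: "nat \<Rightarrow> 'a"
    by (rule sum.reindex_bij_witness[of _ "\<lambda>j. j - 1" Suc]) auto
  have "U * W = 1\<^sub>m n"
  proof (rule eq_matI)
    fix k l assume "k < dim_row (1\<^sub>m n :: 'a mat)" "l < dim_col (1\<^sub>m n :: 'a mat)"
    hence kl: "k < n" "l < n" by auto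
    have "(U * W) $$ (k, l) = (\<Sum>j<n. S (Suc j) k * w (Suc j) l)"
      using kl by (simp add: U_def W_def scalar_prod_def atLeast0LessThan)
    also have "\<dots> = (\<Sum>j=1..n. S j k * w j l)"
      by (rule shift_index)
    also have "\<dots> = rec_unit n c l k"
      unfolding w by (simp add: seq_apply)
    finally show "(U * W) $$ (k, l) = 1\<^sub>m n $$ (k, l)"
      using kl by (simp add: rec_unit_apply)
  qed (auto simp: U_def W_def)
  moreover have "W * U = 1\<^sub>m n"
  proof (rule eq_matI)
    fix i j assume "i < dim_row (1\<^sub>m n :: 'a mat)" "j < dim_col (1\<^sub>m n :: 'a mat)"
    hence ij: "i < n" "j < n" by auto
    let ?j = "Suc j"
    have "S ?j \<in> rec_space n c"
      using ij by (intro mem) auto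
    hence "S ?j = (\<Sum>r=1..n. S r \<star> (\<Sum>l<n. w r l * S ?j l))"
      using rec_unit_combination[of "S ?j" n c] combination[of "S ?j"] by (simp only:)
    moreover have "S ?j = (\<Sum>r=1..n. S r \<star> (if r = ?j then 1 else 0))"
    proof -
      have "(\<Sum>r=1..n. S r \<star> (if r = ?j then 1 else 0)) = (\<Sum>r=1..n. if r = ?j then S ?j else 0)"
        by (rule sum.cong) auto
      thus ?thesis
        using ij by simp
    qed
    ultimately have "(\<Sum>r=1..n. S r \<star> ((\<Sum>l<n. w r l * S ?j l) - (if r = ?j then 1 else 0))) = 0"
      by (simp only: rscale_diff_right sum_subtractf) simp
    from indep[OF this, of "Suc i"] have "(\<Sum>l<n. w (Suc i) l * S ?j l) = (if i = j then 1 else 0)"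
      using ij by simp
    moreover have "(W * U) $$ (i, j) = (\<Sum>l<n. w (Suc i) l * S ?j l)"
      using ij by (simp add: U_def W_def scalar_prod_def atLeast0LessThan)
    ultimately show "(W * U) $$ (i, j) = 1\<^sub>m n $$ (i, j)"
      using ij by simp
  qed (auto simp: U_def W_def)
  moreover have "(\<Sum>j=1..n. S j \<star> ((W *\<^sub>v vec n init) $ (j - 1))) = rec_solution n c init" for init
  proof -
    have "(\<Sum>j=1..n. S j \<star> ((W *\<^sub>v vec n init) $ (j - 1))) = (\<Sum>j=1..n. S j \<star> (\<Sum>l<n. w j l * init l))"
      by (intro sum.cong refl) (auto simp: W_def scalar_prod_def atLeast0LessThan)
    also have "\<dots> = (\<Sum>l<n. rec_unit n c l \<star> init l)"
      by (rule combination[symmetric])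
    also have "\<dots> = rec_solution n c init"
    proof (rule rec_space_eqI)
      show "(\<Sum>l<n. rec_unit n c l \<star> init l) \<in> rec_space n c"
        by (intro sum_mem scale_mem rec_unit_mem)
      show "(\<Sum>l<n. rec_unit n c l \<star> init l) i = rec_solution n c init i" if "i < n" for i
        using that by (simp only: rec_unit_combination_apply rec_solution_init)
    qed (rule rec_solution_mem)
    finally show ?thesis .
  qed
  moreover have "U \<in> carrier_mat n n" "W \<in> carrier_mat n n"
    by (simp_all add: U_def W_def)
  ultimately show ?thesis
    unfolding inverts_mat_def by (intro exI[of _ U] exI[of _ W]) auto
qed

section \<open>Enumeration of the basis in blocks\<close>

text \<open>The positions \<open>1, \<dots>, M t\<close> are divided into consecutive blocks, the \<open>i\<close>-th of which has
  length \<open>m i\<close> and ends at \<open>M i\<close>.\<close>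

lemma sum_blocks:
  fixes M :: "nat \<Rightarrow> nat"
  assumes "\<And>i. M i = (\<Sum>l=1..i. m l)"
  shows "(\<Sum>i=1..t. \<Sum>j=M (i - 1) + 1..M i. f j) = (\<Sum>j=1..M t. f j)"
proof (induction t)
  case (Suc t)
  have "M t \<le> M (Suc t)"
    by (simp add: assms)
  hence "{1..M (Suc t)} = {1..M t} \<union> {M t + 1..M (Suc t)}"
    by auto
  hence "(\<Sum>j=1..M (Suc t). f j) = (\<Sum>j=1..M t. f j) + (\<Sum>j=M t + 1..M (Suc t). f j)"
    by (simp only:) (rule sum.union_disjoint, auto)
  thus ?case
    using Suc by simp
qed (simp add: assms)

lemma sum_block_offset:
  fixes M :: "nat \<Rightarrow> nat"
  assumes "\<And>i. M i = (\<Sum>l=1..i. m l)" "i \<ge> 1"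
  shows "(\<Sum>q<m i. f q) = (\<Sum>j=M (i - 1) + 1..M i. f (j - M (i - 1) - 1))"
proof -
  obtain i' where i': "i = Suc i'"
    using assms(2) by (cases i) auto
  have "M i = M (i - 1) + m i"
    by (simp add: assms i')
  thus ?thesis
    by (intro sum.reindex_bij_witness[of _ "\<lambda>j. j - M (i - 1) - 1" "\<lambda>q. M (i - 1) + 1 + q"]) auto
qed

lemma block_Least:
  fixes M :: "nat \<Rightarrow> nat"
  assumes "\<And>i. M i = (\<Sum>l=1..i. m l)" "j \<in> {M (i - 1) + 1..M i}"
  shows "(LEAST i. j \<le> M i) = i"
proof (rule Least_equality)
  fix i' assume i': "j \<le> M i'"
  show "i \<le> i'"
  proof (rule ccontr)
    assume "\<not> i \<le> i'"
    hence "M i' \<le> M (i - 1)"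
      unfolding assms(1) by (intro sum_mono2) auto
    thus False
      using i' assms(2) by simp
  qed
qed (use assms(2) in auto)

section \<open>The solution formula\<close>

theorem theorem1p2:
  fixes n :: nat
    and c init :: "nat \<Rightarrow> 'a::{division_ring, ring_char_0}"
    and \<phi> :: "'a cpoly"
  assumes "central_division_algebra TYPE('a)"
    and "n \<ge> 1"
    and "c 0 \<noteq> 0"
    and "is_center_minpoly (recurrence_companion n c) \<phi>"
    and "product_of_linear_factors \<phi>"
  shows "\<exists>(t::nat) (lam :: nat \<Rightarrow> 'a) (m :: nat \<Rightarrow> nat) (U :: 'a mat) (V :: 'a mat)
            (p :: nat \<Rightarrow> 'a cpoly) (M :: nat \<Rightarrow> nat).
     inj_on lam {1..t} \<and>
     (\<forall>i\<in>{1..t}. left_eigenvalue (recurrence_companion n c) (lam i)) \<and>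
     (\<forall>i\<in>{1..t}. m i > 0) \<and>
     (\<Sum>i=1..t. m i) = n \<and>
     U \<in> carrier_mat n n \<and> V \<in> carrier_mat n n \<and> inverts_mat U V \<and> inverts_mat V U \<and>
     (\<forall>i. M i = (\<Sum>l=1..i. m l)) \<and>
     (\<forall>i\<in>{1..t}. \<forall>j\<in>{M (i - 1) + 1..M i}. cdeg (p j) < m i) \<and>
     (let b = (\<lambda>j. (V *\<^sub>v vec n init) $ (j - 1))
      in \<forall>a. solves_recurrence n c init a \<longleftrightarrow>
           (\<forall>k. a k = (\<Sum>i=1..t. \<Sum>j=M (i - 1) + 1..M i.
                          ceval (p j) (of_nat k) * lam i ^ k * b j)))"
proof -
  interpret shift_space "rec_space n c"
    by (rule shift_space_rec_space)
  have ann: "center_annihilator (recurrence_companion n c) \<phi>"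
    using assms(4) by (simp add: is_center_minpoly_def)
  have units: "finite (rec_unit n c ` {..<n})" "rec_unit n c ` {..<n} \<subseteq> rec_space n c"
    using rec_unit_mem by auto
  have central: "\<And>s. Poly_Mapping.lookup \<phi> s \<in> ring_center" and monic: "cmonic \<phi>"
    using ann by (auto simp: center_annihilator_def)
  have kill: "act v \<phi> = 0" if "v \<in> rec_space n c" for v
    using act_center_annihilator[OF ann assms(2) that] .
  obtain t v lam m where basis: "jordan_basis (rec_space n c) t v lam m"
    using exists_jordan_basis[OF shift_space_rec_space units rec_space_subset_rspan
        central monic assms(5) kill] by blast
  have inj: "inj_on lam {1..t}"
    and m_pos: "\<And>i. i \<in> {1..t} \<Longrightarrow> m i > 0"
    and v_mem: "\<And>i. i \<in> {1..t} \<Longrightarrow> v i \<in> rec_space n c"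
    and v_top: "\<And>i. i \<in> {1..t} \<Longrightarrow> (sdiff (lam i) ^^ m i) (v i) = 0"
    and v_bottom: "\<And>i k. i \<in> {1..t} \<Longrightarrow> (sdiff (lam i) ^^ (m i - 1)) (v i) k = lam i ^ k"
    using basis unfolding jordan_basis_def by blast+
  have v_span: "\<exists>d. x = (\<Sum>i=1..t. \<Sum>q<m i. (sdiff (lam i) ^^ q) (v i) \<star> d i q)"
    if "x \<in> rec_space n c" for x
    using basis that unfolding jordan_basis_def by blast
  have v_indep: "d i q = 0"
    if "(\<Sum>i=1..t. \<Sum>q<m i. (sdiff (lam i) ^^ q) (v i) \<star> d i q) = 0" "i \<in> {1..t}" "q < m i"
    for d i q
    using basis that unfolding jordan_basis_def by blast
  have pow_mem: "(\<lambda>k. lam i ^ k) \<in> rec_space n c" if "i \<in> {1..t}" for i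
  proof -
    have "(sdiff (lam i) ^^ (m i - 1)) (v i) = (\<lambda>k. lam i ^ k)"
      using v_bottom[OF that] by (rule ext)
    thus ?thesis
      using funpow_sdiff_mem[OF v_mem[OF that], of "m i - 1" "lam i"] by simp
  qed
  define M where "M = (\<lambda>i. \<Sum>l=1..i. m l)"
  have M: "M i = (\<Sum>l=1..i. m l)" for i
    by (simp add: M_def)
  \<comment> \<open>Position \<open>j\<close> holds member \<open>off j\<close>, counted from 0, of chain \<open>blk j\<close>.\<close>
  define blk where "blk = (\<lambda>j. LEAST i. j \<le> M i)"
  define off where "off = (\<lambda>j. j - M (blk j - 1) - 1)"
  have blk: "blk j = i" if "j \<in> {M (i - 1) + 1..M i}" for i j
    unfolding blk_def by (rule block_Least[OF M that])
  have blk_off: "blk j \<in> {1..t}" "j \<in> {M (blk j - 1) + 1..M (blk j)}" if "j \<in> {1..M t}" for j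
  proof -
    have "j \<le> M (blk j)" "blk j \<le> t"
      unfolding blk_def using that by (auto intro: LeastI[of _ t] Least_le)
    moreover have "blk j \<noteq> 0"
      using \<open>j \<le> M (blk j)\<close> that M[of 0] by (intro notI) simp
    moreover have "\<not> j \<le> M (blk j - 1)"
      using not_less_Least[of "blk j - 1" "\<lambda>i. j \<le> M i"] \<open>blk j \<noteq> 0\<close> by (simp add: blk_def)
    ultimately show "blk j \<in> {1..t}" "j \<in> {M (blk j - 1) + 1..M (blk j)}"
      by auto
  qed
  define S where "S = (\<lambda>j. (sdiff (lam (blk j)) ^^ off j) (v (blk j)))"
  have S_sum: "(\<Sum>i=1..t. \<Sum>q<m i. (sdiff (lam i) ^^ q) (v i) \<star> d i q) =
      (\<Sum>j=1..M t. S j \<star> d (blk j) (off j))" for d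
  proof -
    have "(\<Sum>q<m i. (sdiff (lam i) ^^ q) (v i) \<star> d i q) =
        (\<Sum>j=M (i - 1) + 1..M i. S j \<star> d (blk j) (off j))" if "i \<in> {1..t}" for i
    proof -
      have "(\<Sum>q<m i. (sdiff (lam i) ^^ q) (v i) \<star> d i q) =
          (\<Sum>j=M (i - 1) + 1..M i. (sdiff (lam i) ^^ (j - M (i - 1) - 1)) (v i) \<star> d i (j - M (i - 1) - 1))"
        by (rule sum_block_offset[OF M]) (use that in auto)
      also have "\<dots> = (\<Sum>j=M (i - 1) + 1..M i. S j \<star> d (blk j) (off j))"
        by (rule sum.cong[OF refl]) (simp only: S_def off_def blk)
      finally show ?thesis .
    qed
    thus ?thesis
      by (simp only: sum_blocks[OF M, symmetric] cong: sum.cong)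
  qed
  have S_mem: "S j \<in> rec_space n c" if "j \<in> {1..M t}" for j
    unfolding S_def by (intro funpow_sdiff_mem v_mem blk_off(1) that)
  have S_span: "\<exists>d. x = (\<Sum>j=1..M t. S j \<star> d j)" if x: "x \<in> rec_space n c" for x
  proof -
    obtain d where "x = (\<Sum>i=1..t. \<Sum>q<m i. (sdiff (lam i) ^^ q) (v i) \<star> d i q)"
      using v_span[OF x] by blast
    thus ?thesis
      unfolding S_sum by (rule exI[of _ "\<lambda>j. d (blk j) (off j)"])
  qed
  have S_indep: "d j = 0" if rel: "(\<Sum>j=1..M t. S j \<star> d j) = 0" and j: "j \<in> {1..M t}" for d j
  proof -
    define d' where "d' = (\<lambda>i q. d (M (i - 1) + 1 + q))"
    have d': "d' (blk j) (off j) = d j" if "j \<in> {1..M t}" for j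
      using blk_off(2)[OF that] by (simp add: d'_def off_def)
    have "(\<Sum>j=1..M t. S j \<star> d' (blk j) (off j)) = (\<Sum>j=1..M t. S j \<star> d j)"
      by (rule sum.cong[OF refl]) (simp only: d')
    hence "(\<Sum>j=1..M t. S j \<star> d' (blk j) (off j)) = 0"
      using rel by simp
    moreover have "off j < m (blk j)"
    proof -
      obtain i' where "blk j = Suc i'"
        using blk_off(1)[OF j] by (cases "blk j") auto
      thus ?thesis
        using blk_off(2)[OF j] by (auto simp: off_def M)
    qed
    ultimately have "d' (blk j) (off j) = 0"
      using blk_off(1)[OF j] by (intro v_indep) (simp_all only: S_sum)
    thus ?thesis
      using d'[OF j] by simp
  qed
  have Mt: "M t = n"
  proof -
    have "card {1..M t} = n"
    proof (rule rec_space_basis_card[where c = c])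
      show "d j = 0" if "(\<Sum>j=1..M t. S j \<star> d j) = 0" "j \<in> {1..M t}" for d j
        using that by (rule S_indep)
    qed (use S_mem S_span in auto)
    thus ?thesis by simp
  qed
  obtain U W where UW: "U \<in> carrier_mat n n" "W \<in> carrier_mat n n"
    "inverts_mat U W" "inverts_mat W U"
    and W: "(\<Sum>j=1..n. S j \<star> ((W *\<^sub>v vec n init) $ (j - 1))) = rec_solution n c init"
  proof -
    have "\<exists>U W. U \<in> carrier_mat n n \<and> W \<in> carrier_mat n n \<and> inverts_mat U W \<and> inverts_mat W U \<and>
      (\<forall>init. (\<Sum>j=1..n. S j \<star> ((W *\<^sub>v vec n init) $ (j - 1))) = rec_solution n c init)"
    proof (rule rec_space_basis_matrices[where c = c])
      show "d j = 0" if "(\<Sum>j=1..n. S j \<star> d j) = 0" "j \<in> {1..n}" for d j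
        using that unfolding Mt[symmetric] by (rule S_indep)
    qed (use S_mem S_span in \<open>auto simp: Mt\<close>)
    thus thesis
      using that by blast
  qed
  have "\<exists>p. cdeg p < m (blk j) \<and> (\<forall>k. S j k = ceval p (of_nat k) * lam (blk j) ^ k)"
    if "j \<in> {1..n}" for j
  proof (rule gen_eigen_polynomial_exponential)
    have i: "blk j \<in> {1..t}"
      using blk_off(1) that Mt by simp
    have "(sdiff (lam (blk j)) ^^ m (blk j)) (S j) =
        (sdiff (lam (blk j)) ^^ off j) ((sdiff (lam (blk j)) ^^ m (blk j)) (v (blk j)))"
      unfolding S_def by (rule funpow_left_commute)
    thus "(sdiff (lam (blk j)) ^^ m (blk j)) (S j) = 0"
      using v_top[OF i] by simp
    show "lam (blk j) \<noteq> 0"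
      using power_rec_space_nonzero[OF pow_mem[OF i]] assms(2,3) by simp
    show "m (blk j) > 0"
      by (rule m_pos[OF i])
  qed
  then obtain p where p: "\<And>j. j \<in> {1..n} \<Longrightarrow> cdeg (p j) < m (blk j)"
    "\<And>j k. j \<in> {1..n} \<Longrightarrow> S j k = ceval (p j) (of_nat k) * lam (blk j) ^ k"
    by metis
  have block_subset: "j \<in> {1..n}" if "i \<in> {1..t}" "j \<in> {M (i - 1) + 1..M i}" for i j
  proof -
    have "M i \<le> M t"
      unfolding M using that(1) by (intro sum_mono2) auto
    thus ?thesis
      using that(2) Mt by simp
  qed
  define b where "b = (\<lambda>j. (W *\<^sub>v vec n init) $ (j - 1))"
  have formula: "(\<Sum>i=1..t. \<Sum>j=M (i - 1) + 1..M i. ceval (p j) (of_nat k) * lam i ^ k * b j) =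
      rec_solution n c init k" for k
  proof -
    have "(\<Sum>i=1..t. \<Sum>j=M (i - 1) + 1..M i. ceval (p j) (of_nat k) * lam i ^ k * b j) =
        (\<Sum>i=1..t. \<Sum>j=M (i - 1) + 1..M i. S j k * b j)"
      by (intro sum.cong refl) (simp only: p(2)[OF block_subset] blk)
    also have "\<dots> = (\<Sum>j=1..n. S j k * b j)"
      unfolding sum_blocks[OF M] Mt ..
    also have "\<dots> = (\<Sum>j=1..n. S j \<star> b j) k"
      by (simp add: seq_apply)
    finally show ?thesis
      unfolding b_def W .
  qed
  have solution: "solves_recurrence n c init a \<longleftrightarrow>
      (\<forall>k. a k = (\<Sum>i=1..t. \<Sum>j=M (i - 1) + 1..M i. ceval (p j) (of_nat k) * lam i ^ k * b j))" for a
  proof -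
    have "solves_recurrence n c init a \<longleftrightarrow> a = rec_solution n c init"
      unfolding solves_recurrence_iff
      using rec_space_eqI[of a n c "rec_solution n c init"] rec_solution_mem[of n c init]
        rec_solution_init[of _ n c init] by auto
    thus ?thesis
      unfolding formula by (simp add: fun_eq_iff)
  qed
  show ?thesis
  proof (intro exI conjI ballI allI)
    show "inj_on lam {1..t}"
      by (rule inj)
    show "left_eigenvalue (recurrence_companion n c) (lam i)" if "i \<in> {1..t}" for i
      by (rule left_eigenvalue_companion[OF pow_mem[OF that] assms(2)])
    show "m i > 0" if "i \<in> {1..t}" for i
      by (rule m_pos[OF that])
    show "(\<Sum>i=1..t. m i) = n"
      using Mt M by simp
    show "M i = (\<Sum>l=1..i. m l)" for i
      by (rule M)
    show "cdeg (p j) < m i" if "i \<in> {1..t}" "j \<in> {M (i - 1) + 1..M i}" for i j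
      using p(1)[OF block_subset[OF that]] blk[OF that(2)] by simp
    show "let b = (\<lambda>j. (W *\<^sub>v vec n init) $ (j - 1))
      in \<forall>a. solves_recurrence n c init a \<longleftrightarrow>
           (\<forall>k. a k = (\<Sum>i=1..t. \<Sum>j=M (i - 1) + 1..M i.
                          ceval (p j) (of_nat k) * lam i ^ k * b j))"
      unfolding Let_def using solution unfolding b_def by blast
  qed (fact UW)+
qed

end
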